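(* Let $\hat\vartheta$ and $\hat\vartheta_N$ denote the optimal values of $$\min_{\nu\in\mathcal{V}}\ \max_{\xi\in\Xi}\ h_\xi(\nu)\qquad\text{and}\qquad \min_{\nu\in\mathcal{V}}\ \max_{\xi\in\Xi_{[N]}}\ h_\xi(\nu),$$ respectively, where $\Xi_{[N]}=\{\xi^1,\dots,\xi^N\}$. Suppose that, for fixed $x\in\Delta_d$ and $\alpha\in\mathbb{R}$, the optimal value of $$\max_{P\in\mathscr{P}}\ \mathbb{E}_P[\hat K(x,\alpha,\xi)]$$ is finite, and that $\xi^1,\dots,\xi^N$ are independent and identically distributed samples of $\xi$ following a continuous probability distribution $P$ over $\Xi$ such that $$P\big(\|\xi-\xi^0\|<\delta\big)\ \ge\ C_2\,\delta^{\gamma_2}$$ for any fixed point $\xi^0\in\Xi$ and any $\delta\in(0,\delta_0)$, where $C_2,\gamma_2,\delta_0$ are some positive constants. Then for any $\varepsilon>0$ there exist positive constants $\hat C(\varepsilon)$ and $\hat\beta(\varepsilon)$, independent of $N$, such that for all sufficiently large $N$ $$\mathrm{Prob}\big(|\hat\vartheta_N-\hat\vartheta|\ge\varepsilon\big)\ \le\ \hat C(\varepsilon)\,e^{-\hat\beta(\varepsilon)N}.$$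
   Context: $\mathrm{Prob}$ is the probability with respect to the random sampling of $\xi^1,\dots,\xi^N$. $\Delta_d=\{x\in\mathbb{R}^d : \sum_{i=1}^d x_i=1,\ x\ge 0\}$. $\mathbb{S}_+^{d+1}$ is the cone of symmetric positive semidefinite $(d+1)\times(d+1)$ matrices; $M\preceq N$ means $N-M$ is positive semidefinite; $\|\cdot\|$ is the Euclidean norm; $[t]_+=\max\{t,0\}$; $\langle M,N\rangle=\sum_{i,j}M_{i,j}N_{i,j}$. $\nu=(x,\alpha,q,\Lambda)$ and $\mathcal{V}=\Delta_d\times\mathbb{R}\times\mathbb{R}^{d+1}\times\mathbb{S}_+^{d+1}$. $\Xi\subseteq\mathbb{R}^{d+1}$ is a convex compact set with Borel $\sigma$-algebra, and $\mathcal{M}$ is the set of all Borel probability measures on $\Xi$. Elements are written $\xi=(\xi_B^\top,\xi_a)^\top$ with $\xi_B\in\mathbb{R}^d$, $\xi_a\in\mathbb{R}$. The vector $\hat\mu\in\mathbb{R}^{d+1}$ and the symmetric positive definite matrix $\hat\Sigma$ are the mean vector and covariance matrix of finitely many historical observations of the random vector $\xi$, all lying in $\Xi$. The function $\psi:\mathbb{R}\to\mathbb{R}$ is convex (for instance $\psi(a)=|a|$ or $\psi(a)=a^2$), $\tau_1,\tau_2\ge 0$, $\beta\in(0,1)$, $\kappa_1>0$, $\kappa_2>0$. The ambiguity set is $$\mathscr{P}=\Big\{P\in\mathcal{M} : (\mathbb{E}_P[\xi]-\hat\mu)^\top\hat\Sigma^{-1}(\mathbb{E}_P[\xi]-\hat\mu)\le\kappa_1,\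 \ \mathbb{E}_P\big[(\xi-\hat\mu)(\xi-\hat\mu)^\top\big]\preceq\kappa_2\hat\Sigma\Big\},$$ and $$\hat K(x,\alpha,\xi)=\psi(\xi_a-\xi_B^\top x)+\frac{\tau_2}{1-\beta}\big[-x^\top\xi_B-\alpha\big]_++\tau_1\|x\|^2+\tau_2\alpha.$$ The function $h_\xi$ is $$h_\xi(\nu)=h_1(\nu)+\sqrt{\kappa_1}\,\big\|\hat\Sigma^{1/2}(q+2\Lambda\hat\mu)\big\|+h_{2,\xi}(\nu),$$ $$h_1(\nu)=\langle\kappa_2\hat\Sigma,\Lambda\rangle+(\Lambda^\top\hat\mu+q)^\top\hat\mu+\tau_1\|x\|^2+\tau_2\alpha,$$ $$h_{2,\xi}(\nu)=\psi(\xi_a-\xi_B^\top x)-(\Lambda^\top\xi+q)^\top\xi+\frac{\tau_2}{1-\beta}\big[-x^\top\xi_B-\alpha\big]_+.$$ *)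

theory Defs
  imports "HOL-Probability.Probability"
begin

text \<open>
  A vector of dimension d + 1 is indexed by the type 'd option, where 'd has d elements: the
  components Some i form the block with index B, and the component None is the last entry.
\<close>

definition part_B :: "real ^ ('d::finite option) \<Rightarrow> real ^ 'd" where
  "part_B \<xi> = (\<chi> i. \<xi> $ Some i)"

definition part_a :: "real ^ ('d::finite option) \<Rightarrow> real" where
  "part_a \<xi> = \<xi> $ None"

definition unit_simplex :: "(real ^ 'd::finite) set" where
  "unit_simplex = {x. (\<Sum>i\<in>UNIV. x $ i) = 1 \<and> (\<forall>i. 0 \<le> x $ i)}"

definition psd :: "real ^ 'n ^ 'n::finite \<Rightarrow> bool" where
  "psd A \<longleftrightarrow> transpose A = A \<and> (\<forall>v. 0 \<le> v \<bullet> (A *v v))"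

definition pos_def :: "real ^ 'n ^ 'n::finite \<Rightarrow> bool" where
  "pos_def A \<longleftrightarrow> transpose A = A \<and> (\<forall>v. v \<noteq> 0 \<longrightarrow> 0 < v \<bullet> (A *v v))"

definition loewner_le :: "real ^ 'n ^ 'n::finite \<Rightarrow> real ^ 'n ^ 'n \<Rightarrow> bool"  (infix "\<preceq>" 50) where
  "M \<preceq> N \<longleftrightarrow> psd (N - M)"

text \<open>The square root of a positive semidefinite matrix; it is the only matrix with this property.\<close>

definition mat_sqrt :: "real ^ 'n ^ 'n::finite \<Rightarrow> real ^ 'n ^ 'n" where
  "mat_sqrt A = (SOME S. psd S \<and> S ** S = A)"

definition outer :: "real ^ 'n::finite \<Rightarrow> real ^ 'n \<Rightarrow> real ^ 'n ^ 'n" where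
  "outer v w = (\<chi> i j. v $ i * w $ j)"

definition sample_mean :: "nat \<Rightarrow> (nat \<Rightarrow> real ^ 'n::finite) \<Rightarrow> real ^ 'n" where
  "sample_mean m obs = (1 / real m) *\<^sub>R (\<Sum>k<m. obs k)"

text \<open>
  Covariance of the empirical distribution. Dividing by m - 1 instead multiplies it by a constant
  c > 0, which in everything below amounts to replacing \<open>\<kappa>\<^sub>1\<close> and \<open>\<kappa>\<^sub>2\<close> by \<open>c * \<kappa>\<^sub>1\<close> and \<open>c * \<kappa>\<^sub>2\<close>.
\<close>

definition sample_cov :: "nat \<Rightarrow> (nat \<Rightarrow> real ^ 'n::finite) \<Rightarrow> real ^ 'n ^ 'n" where
  "sample_cov m obs =
     (1 / real m) *\<^sub>R (\<Sum>k<m. outer (obs k - sample_mean m obs) (obs k - sample_mean m obs))"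

definition borel_probs :: "(real ^ 'n::finite) set \<Rightarrow> (real ^ 'n) measure set" where
  "borel_probs \<Xi> = {P. prob_space P \<and> sets P = sets (restrict_space borel \<Xi>)}"

definition ambiguity_set ::
  "(real ^ 'n::finite) set \<Rightarrow> real ^ 'n \<Rightarrow> real ^ 'n ^ 'n \<Rightarrow> real \<Rightarrow> real \<Rightarrow> (real ^ 'n) measure set" where
  "ambiguity_set \<Xi> \<mu> \<Sigma> \<kappa>\<^sub>1 \<kappa>\<^sub>2 =
     {P \<in> borel_probs \<Xi>.
        ((\<integral>\<xi>. \<xi> \<partial>P) - \<mu>) \<bullet> (matrix_inv \<Sigma> *v ((\<integral>\<xi>. \<xi> \<partial>P) - \<mu>)) \<le> \<kappa>\<^sub>1 \<and>
        (\<integral>\<xi>. outer (\<xi> - \<mu>) (\<xi> - \<mu>) \<partial>P) \<preceq> \<kappa>\<^sub>2 *\<^sub>R \<Sigma>}"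

definition K_hat ::
  "(real \<Rightarrow> real) \<Rightarrow> real \<Rightarrow> real \<Rightarrow> real \<Rightarrow> real ^ 'd \<Rightarrow> real \<Rightarrow> real ^ ('d::finite option) \<Rightarrow> real" where
  "K_hat \<psi> \<tau>\<^sub>1 \<tau>\<^sub>2 \<beta> x \<alpha> \<xi> =
     \<psi> (part_a \<xi> - part_B \<xi> \<bullet> x) + \<tau>\<^sub>2 / (1 - \<beta>) * max (- (x \<bullet> part_B \<xi>) - \<alpha>) 0
       + \<tau>\<^sub>1 * (norm x)\<^sup>2 + \<tau>\<^sub>2 * \<alpha>"

type_synonym 'd dual_var =
  "(real ^ 'd) \<times> real \<times> (real ^ ('d option)) \<times> (real ^ ('d option) ^ ('d option))"

definition feasible_set :: "'d::finite dual_var set" where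
  "feasible_set = unit_simplex \<times> UNIV \<times> UNIV \<times> {\<Lambda>. psd \<Lambda>}"

text \<open>
  The inner product of two matrices is the library's inner product on vectors of vectors, i.e. the
  sum of the products of corresponding entries.
\<close>

fun h1 :: "real ^ ('d::finite option) \<Rightarrow> real ^ ('d option) ^ ('d option) \<Rightarrow> real \<Rightarrow> real \<Rightarrow> real \<Rightarrow>
    'd dual_var \<Rightarrow> real" where
  "h1 \<mu> \<Sigma> \<kappa>\<^sub>2 \<tau>\<^sub>1 \<tau>\<^sub>2 (x, \<alpha>, q, \<Lambda>) =
     (\<kappa>\<^sub>2 *\<^sub>R \<Sigma>) \<bullet> \<Lambda> + (transpose \<Lambda> *v \<mu> + q) \<bullet> \<mu> + \<tau>\<^sub>1 * (norm x)\<^sup>2 + \<tau>\<^sub>2 * \<alpha>"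

fun h2 :: "(real \<Rightarrow> real) \<Rightarrow> real \<Rightarrow> real \<Rightarrow> real ^ ('d::finite option) \<Rightarrow> 'd dual_var \<Rightarrow> real" where
  "h2 \<psi> \<tau>\<^sub>2 \<beta> \<xi> (x, \<alpha>, q, \<Lambda>) =
     \<psi> (part_a \<xi> - part_B \<xi> \<bullet> x) - (transpose \<Lambda> *v \<xi> + q) \<bullet> \<xi>
       + \<tau>\<^sub>2 / (1 - \<beta>) * max (- (x \<bullet> part_B \<xi>) - \<alpha>) 0"

fun h_mid :: "real ^ ('d::finite option) \<Rightarrow> real ^ ('d option) ^ ('d option) \<Rightarrow> real \<Rightarrow>
    'd dual_var \<Rightarrow> real" where
  "h_mid \<mu> \<Sigma> \<kappa>\<^sub>1 (x, \<alpha>, q, \<Lambda>) = sqrt \<kappa>\<^sub>1 * norm (mat_sqrt \<Sigma> *v (q + 2 *\<^sub>R (\<Lambda> *v \<mu>)))"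

definition h_fun ::
  "(real \<Rightarrow> real) \<Rightarrow> real ^ ('d::finite option) \<Rightarrow> real ^ ('d option) ^ ('d option) \<Rightarrow>
   real \<Rightarrow> real \<Rightarrow> real \<Rightarrow> real \<Rightarrow> real \<Rightarrow> real ^ ('d option) \<Rightarrow> 'd dual_var \<Rightarrow> real" where
  "h_fun \<psi> \<mu> \<Sigma> \<kappa>\<^sub>1 \<kappa>\<^sub>2 \<tau>\<^sub>1 \<tau>\<^sub>2 \<beta> \<xi> \<nu> =
     h1 \<mu> \<Sigma> \<kappa>\<^sub>2 \<tau>\<^sub>1 \<tau>\<^sub>2 \<nu> + h_mid \<mu> \<Sigma> \<kappa>\<^sub>1 \<nu> + h2 \<psi> \<tau>\<^sub>2 \<beta> \<xi> \<nu>"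

text \<open>
  Optimal values are extended reals: for a small finite set X of samples the problem may be
  unbounded below.
\<close>

definition opt_value ::
  "(real \<Rightarrow> real) \<Rightarrow> real ^ ('d::finite option) \<Rightarrow> real ^ ('d option) ^ ('d option) \<Rightarrow>
   real \<Rightarrow> real \<Rightarrow> real \<Rightarrow> real \<Rightarrow> real \<Rightarrow> (real ^ ('d option)) set \<Rightarrow> ereal" where
  "opt_value \<psi> \<mu> \<Sigma> \<kappa>\<^sub>1 \<kappa>\<^sub>2 \<tau>\<^sub>1 \<tau>\<^sub>2 \<beta> X =
     (INF \<nu>\<in>feasible_set. SUP \<xi>\<in>X. ereal (h_fun \<psi> \<mu> \<Sigma> \<kappa>\<^sub>1 \<kappa>\<^sub>2 \<tau>\<^sub>1 \<tau>\<^sub>2 \<beta> \<xi> \<nu>))"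

end

theory Submission
  imports Defs
begin

text \<open>
  With \<open>y = \<xi> - \<mu>\<close> and \<open>p = q + 2 \<Lambda> \<mu>\<close>, the objective \<open>h\<^sub>\<xi>(\<nu>)\<close> depends on \<open>\<xi>\<close> only through
  \<open>\<psi>(\<xi>\<^sub>a - \<xi>\<^sub>B \<bullet> x) - y \<bullet> \<Lambda> y - p \<bullet> y\<close> and the positive part. At \<open>\<xi> = \<mu>\<close>, which lies in \<open>\<Xi>\<close> because
  \<open>\<mu>\<close> is a sample mean, the terms with y vanish, and positive definiteness of \<open>\<Sigma>\<close> makes \<open>h\<^sub>\<mu>(\<nu>)\<close>
  coercive in \<open>(\<Lambda>, p)\<close>; this persists for \<open>\<xi>\<close> close to \<open>\<mu>\<close>. Hence, as soon as the sample is a sufficiently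
  fine net of \<open>\<Xi>\<close>, the near-optimal \<open>\<nu>\<close> of the sampled problem have bounded \<open>\<Lambda>\<close> and p, and on such \<open>\<nu>\<close>
  the functions \<open>\<xi> \<mapsto> h\<^sub>\<xi>(\<nu>)\<close> are uniformly equicontinuous, so both optimal values are close. The sample
  fails to be a net only if it misses one of finitely many balls of positive probability, and the
  probability of this decays exponentially in N.
\<close>

section \<open>Positive definite matrices: quadratic forms and square roots\<close>

lemma symmetric_inner_mult:
  fixes A :: "real ^ 'n ^ 'n::finite"
  assumes "transpose A = A"
  shows "(A *v v) \<bullet> w = v \<bullet> (A *v w)"
  by (metis assms dot_lmul_matrix vector_transpose_matrix)

text \<open>The form attains a positive minimum on the compact unit sphere, and homogeneity of
  degree two carries this bound to all vectors.\<close>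

lemma pos_def_quadratic_lower_bound:
  fixes A :: "real ^ 'n ^ 'n::finite"
  assumes "pos_def A"
  obtains c where "c > 0" "\<And>v. c * (norm v)\<^sup>2 \<le> v \<bullet> (A *v v)"
proof -
  define K where "K = sphere (0 :: real ^ 'n) 1"
  have "axis undefined 1 \<in> K" by (simp add: K_def)
  then have "K \<noteq> {}" by blast
  moreover have "continuous_on K (\<lambda>v. v \<bullet> (A *v v))"
    by (intro continuous_intros linear_continuous_on) auto
  ultimately obtain u where u: "u \<in> K" "\<And>v. v \<in> K \<Longrightarrow> u \<bullet> (A *v u) \<le> v \<bullet> (A *v v)"
    using continuous_attains_inf[of K] compact_sphere unfolding K_def by blast
  show ?thesis
  proof
    have "u \<noteq> 0" using u(1) by (auto simp: K_def)
    then show "0 < u \<bullet> (A *v u)" using assms by (simp add: pos_def_def)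
    show "u \<bullet> (A *v u) * (norm v)\<^sup>2 \<le> v \<bullet> (A *v v)" for v
    proof (cases "v = 0")
      case False
      have "v /\<^sub>R norm v \<in> K" using False by (simp add: K_def)
      from u(2)[OF this] have "u \<bullet> (A *v u) \<le> v \<bullet> (A *v v) / (norm v)\<^sup>2"
        by (simp add: matrix_vector_mult_scaleR power2_eq_square divide_inverse ac_simps)
      then show ?thesis using False by (simp add: field_simps)
    qed simp
  qed
qed

text \<open>If \<open>Y\<close> solves \<open>2 Y = B + Y\<^sup>2\<close>, then \<open>(1 - Y)\<^sup>2 = 1 - B\<close>; such a \<open>Y\<close> is the fixed point of a
  contraction as soon as the norm of \<open>B\<close> is less than 1.\<close>

lemma quadratic_fixed_point_exists:
  fixes B :: "'a::euclidean_space \<Rightarrow>\<^sub>L 'a"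
  assumes "norm B < 1" and sym: "\<And>v w. B v \<bullet> w = v \<bullet> B w"
  obtains Y :: "'a \<Rightarrow>\<^sub>L 'a" where "norm Y \<le> norm B"
    "\<And>v w. blinfun_apply Y v \<bullet> w = v \<bullet> blinfun_apply Y w" "2 *\<^sub>R Y = B + (Y o\<^sub>L Y)"
proof -
  define r where "r = norm B"
  \<comment> \<open>Symmetry is built into the set, which stays closed, so that the fixed point
    inherits it.\<close>
  define S where "S = {Y :: 'a \<Rightarrow>\<^sub>L 'a. norm Y \<le> r \<and> (\<forall>v w. blinfun_apply Y v \<bullet> w = v \<bullet> blinfun_apply Y w)}"
  define f where "f Y = (1/2) *\<^sub>R (B + (Y o\<^sub>L Y))" for Y :: "'a \<Rightarrow>\<^sub>L 'a"
  have r: "0 \<le> r" "r < 1" using assms by (auto simp: r_def)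
  have S_closed: "closed S"
    unfolding S_def
    by (intro closed_Collect_conj closed_Collect_all closed_Collect_le closed_Collect_eq continuous_intros)
  have "0 \<in> S" using r by (simp add: S_def)
  moreover have "f ` S \<subseteq> S"
  proof (clarsimp simp: S_def)
    fix Y :: "'a \<Rightarrow>\<^sub>L 'a"
    assume Y: "norm Y \<le> r" "\<forall>v w. blinfun_apply Y v \<bullet> w = v \<bullet> blinfun_apply Y w"
    have "norm (Y o\<^sub>L Y) \<le> norm Y * norm Y" by (rule norm_blinfun_compose)
    also have "\<dots> \<le> r * 1" using Y r by (intro mult_mono) auto
    finally have "norm (B + (Y o\<^sub>L Y)) \<le> r + r"
      using norm_triangle_ineq[of B "Y o\<^sub>L Y"] by (simp add: r_def)
    then have "norm (f Y) \<le> r" by (simp add: f_def)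
    moreover have "f Y v \<bullet> w = v \<bullet> f Y w" for v w
      using Y sym by (simp add: f_def blinfun.bilinear_simps inner_add_left inner_add_right)
    ultimately show "norm (f Y) \<le> r \<and> (\<forall>v w. f Y v \<bullet> w = v \<bullet> f Y w)" by blast
  qed
  moreover have "dist (f Y) (f Z) \<le> r * dist Y Z" if "Y \<in> S" "Z \<in> S" for Y Z
  proof -
    \<comment> \<open>\<open>Y\<close> and \<open>Z\<close> need not commute, so the difference of
      their squares is split as \<open>Y (Y - Z) + (Y - Z) Z\<close>; each summand contributes at
      most \<open>r\<close> times the distance, and the factor 1/2 brings the sum back to
      \<open>r\<close>.\<close>
    have "f Y - f Z = (1/2) *\<^sub>R ((Y o\<^sub>L (Y - Z)) + ((Y - Z) o\<^sub>L Z))"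
      by (auto intro!: blinfun_eqI simp: f_def blinfun.bilinear_simps algebra_simps)
    then have "norm (f Y - f Z) \<le> 1/2 * (norm (Y o\<^sub>L (Y - Z)) + norm ((Y - Z) o\<^sub>L Z))"
      by (simp add: norm_triangle_ineq)
    also have "\<dots> \<le> 1/2 * (norm Y * norm (Y - Z) + norm (Y - Z) * norm Z)"
      by (intro mult_left_mono add_mono norm_blinfun_compose) auto
    also have "\<dots> \<le> 1/2 * (r * norm (Y - Z) + norm (Y - Z) * r)"
      using that by (intro mult_left_mono add_mono mult_right_mono) (auto simp: S_def)
    finally show ?thesis by (simp add: dist_norm)
  qed
  ultimately have "\<exists>!Y\<in>S. f Y = Y"
    using S_closed r by (intro Banach_fix[of S r f]) (auto simp: complete_eq_closed)
  then obtain Y where "Y \<in> S" "f Y = Y" by blast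
  moreover have "2 *\<^sub>R f Y = B + (Y o\<^sub>L Y)" by (simp add: f_def)
  ultimately show ?thesis by (intro that[of Y]) (auto simp: S_def r_def)
qed

text \<open>Polarization: for a vector \<open>u\<close> as long as \<open>v\<close>,
  \<open>4 * (u \<bullet> B v)\<close> is the form at \<open>u + v\<close> minus the form at
  \<open>u - v\<close>, hence at most \<open>4 * r * (norm v)\<^sup>2\<close>. Taking
  \<open>u\<close> in the direction of \<open>B v\<close> turns the left side into
  \<open>4 * norm v * norm (B v)\<close>.\<close>

lemma symmetric_norm_le_of_quadratic_form:
  fixes B :: "'a::euclidean_space \<Rightarrow>\<^sub>L 'a"
  assumes sym: "\<And>v w. B v \<bullet> w = v \<bullet> B w"
    and B: "\<And>v. 0 \<le> v \<bullet> B v" "\<And>v. v \<bullet> B v \<le> r * (norm v)\<^sup>2" and r: "r \<ge> 0"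
  shows "norm B \<le> r"
proof (rule norm_blinfun_bound[OF r])
  fix v
  show "norm (B v) \<le> r * norm v"
  proof (cases "B v = 0")
    case False
    then have "v \<noteq> 0" by auto
    define u where "u = (norm v / norm (B v)) *\<^sub>R B v"
    have nu: "norm u = norm v" using False by (simp add: u_def)
    have "4 * (u \<bullet> B v) = (u + v) \<bullet> B (u + v) - (u - v) \<bullet> B (u - v)"
      using sym[of u v] by (simp add: blinfun.bilinear_simps inner_simps inner_commute)
    also have "\<dots> \<le> r * (norm (u + v))\<^sup>2" using B(1)[of "u - v"] B(2)[of "u + v"] by linarith
    also have "\<dots> \<le> r * (2 * norm v)\<^sup>2"
      using norm_triangle_ineq[of u v] nu by (intro mult_left_mono power_mono r) auto
    finally have "u \<bullet> B v \<le> r * (norm v)\<^sup>2" by (simp add: power_mult_distrib)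
    moreover have "u \<bullet> B v = norm v * norm (B v)"
      using False by (simp add: u_def dot_square_norm power2_eq_square)
    ultimately show ?thesis using \<open>v \<noteq> 0\<close> by (simp add: power2_eq_square ac_simps)
  qed (simp add: r)
qed

text \<open>After scaling, \<open>B = 1 - A / c\<close> is symmetric with norm below 1, so there is
  a symmetric \<open>Y\<close> with \<open>2 Y = B + Y\<^sup>2\<close>. Then
  \<open>(1 - Y)\<^sup>2 = 1 - B = A / c\<close>, and \<open>sqrt c\<close> times
  \<open>1 - Y\<close> is a root; it is positive semidefinite because the norm of \<open>Y\<close>
  is below 1.\<close>

lemma pos_def_sqrt_exists:
  fixes A :: "real ^ 'n ^ 'n::finite"
  assumes "pos_def A"
  shows "\<exists>S. psd S \<and> S ** S = A"
proof -
  from assms have symA: "transpose A = A" by (simp add: pos_def_def)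
  obtain a where a: "a > 0" "\<And>v. a * (norm v)\<^sup>2 \<le> v \<bullet> (A *v v)"
    using pos_def_quadratic_lower_bound[OF assms] by blast
  \<comment> \<open>The operator norm makes \<open>c\<close> dominate the form; the summand
    \<open>a\<close> guarantees \<open>0 < a \<le> c\<close>, so that \<open>r = 1 - a / c\<close>
    lies in [0, 1).\<close>
  define c where "c = a + onorm ((*v) A)"
  have onorm_nonneg: "0 \<le> onorm ((*v) A)" by (simp add: onorm_pos_le)
  then have c: "c > 0" "a \<le> c" using a(1) by (auto simp: c_def)
  have c_bound: "v \<bullet> (A *v v) \<le> c * (norm v)\<^sup>2" for v
  proof -
    have "v \<bullet> (A *v v) \<le> norm v * norm (A *v v)" by (rule norm_cauchy_schwarz)
    also have "\<dots> \<le> norm v * (onorm ((*v) A) * norm v)"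
      by (intro mult_left_mono) (auto intro: Operator_Norm.onorm)
    also have "\<dots> \<le> c * (norm v)\<^sup>2" using a(1) by (simp add: c_def power2_eq_square algebra_simps)
    finally show ?thesis .
  qed
  define r where "r = 1 - a / c"
  have r: "0 \<le> r" "r < 1" using a(1) c by (auto simp: r_def)
  define B where "B = id_blinfun - (1 / c) *\<^sub>R Blinfun ((*v) A)"
  have B_apply: "B v = v - (1 / c) *\<^sub>R (A *v v)" for v
    by (simp add: B_def blinfun.bilinear_simps bounded_linear_Blinfun_apply)
  have B_sym: "B v \<bullet> w = v \<bullet> B w" for v w
    using symmetric_inner_mult[OF symA, of v w] by (simp add: B_apply inner_simps)
  have "norm B \<le> r"
  proof (rule symmetric_norm_le_of_quadratic_form[OF B_sym _ _ r(1)])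
    fix v
    have "v \<bullet> B v = (norm v)\<^sup>2 - v \<bullet> (A *v v) / c"
      by (simp add: B_apply inner_simps dot_square_norm)
    moreover have "v \<bullet> (A *v v) / c \<le> (norm v)\<^sup>2" "a * (norm v)\<^sup>2 / c \<le> v \<bullet> (A *v v) / c"
      using c_bound[of v] a(2)[of v] c(1) by (simp_all add: field_simps)
    ultimately show "0 \<le> v \<bullet> B v" "v \<bullet> B v \<le> r * (norm v)\<^sup>2"
      by (simp_all add: r_def algebra_simps)
  qed
  then obtain Y where Y: "norm Y \<le> r" "\<And>v w. blinfun_apply Y v \<bullet> w = v \<bullet> blinfun_apply Y w" "2 *\<^sub>R Y = B + (Y o\<^sub>L Y)"
    using quadratic_fixed_point_exists[OF _ B_sym] r by (metis order.strict_trans1 order_trans)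
  define S where "S = sqrt c *\<^sub>R (mat 1 - matrix Y)"
  have linY: "linear (blinfun_apply Y)"
    by (simp add: blinfun.bounded_linear_right bounded_linear.linear)
  have S_apply: "S *v v = sqrt c *\<^sub>R (v - Y v)" for v
    by (simp add: S_def scaleR_matrix_vector_assoc[symmetric] matrix_vector_mult_diff_rdistrib
        matrix_works scalar_mult_eq_scaleR[abs_def] linY)
  have "v \<bullet> (S *v w) = (transpose S *v v) \<bullet> w" for v w
    by (metis dot_lmul_matrix vector_transpose_matrix transpose_transpose)
  moreover have "v \<bullet> (S *v w) = (S *v v) \<bullet> w" for v w
    using Y(2)[of v w] by (simp add: S_apply inner_simps)
  ultimately have "transpose S = S"
    by (metis matrix_eq vector_eq_rdot)
  moreover have "0 \<le> v \<bullet> (S *v v)" for v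
  proof -
    have "v \<bullet> Y v \<le> norm v * norm (Y v)" by (rule norm_cauchy_schwarz)
    also have "\<dots> \<le> norm v * (norm Y * norm v)" by (intro mult_left_mono norm_blinfun) auto
    also have "\<dots> \<le> norm v * (1 * norm v)"
      using Y(1) r by (intro mult_left_mono mult_right_mono) auto
    finally show ?thesis
      using c by (simp add: S_apply inner_simps dot_square_norm power2_eq_square)
  qed
  moreover have "S *v (S *v v) = A *v v" for v
  proof -
    have "2 *\<^sub>R Y v = B v + Y (Y v)"
      using arg_cong[OF Y(3), of "\<lambda>Z. blinfun_apply Z v"] by (simp add: blinfun.bilinear_simps)
    then have *: "Y (Y v) = 2 *\<^sub>R Y v - v + (1 / c) *\<^sub>R (A *v v)"
      by (simp add: B_apply algebra_simps)
    have "S *v (S *v v) = (sqrt c * sqrt c) *\<^sub>R (v - Y v - (Y v - Y (Y v)))"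
      by (simp only: S_apply blinfun.bilinear_simps scaleR_diff_right scaleR_scaleR)
    then show ?thesis using c by (simp add: * scaleR_diff_right scaleR_add_right scaleR_2)
  qed
  then have "S ** S = A" by (simp add: matrix_eq matrix_vector_mul_assoc)
  ultimately show ?thesis unfolding psd_def by blast
qed

lemma mat_sqrt_pos_def:
  assumes "pos_def A"
  shows "psd (mat_sqrt A)" "mat_sqrt A ** mat_sqrt A = A"
  using someI_ex[OF pos_def_sqrt_exists[OF assms]] by (auto simp: mat_sqrt_def)

lemma norm_mat_sqrt_mult:
  assumes "pos_def A"
  shows "(norm (mat_sqrt A *v v))\<^sup>2 = v \<bullet> (A *v v)"
proof -
  have "transpose (mat_sqrt A) = mat_sqrt A"
    using mat_sqrt_pos_def(1)[OF assms] by (simp add: psd_def)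
  from symmetric_inner_mult[OF this, of v "mat_sqrt A *v v"] show ?thesis
    by (simp add: matrix_vector_mul_assoc mat_sqrt_pos_def(2)[OF assms] dot_square_norm)
qed

text \<open>The squared norm is the quadratic form of \<open>A\<close>, which is bounded below. This
  makes the middle term of the objective coercive in
  \<open>q + 2 *\<^sub>R (\<Lambda> *v \<mu>)\<close>.\<close>

lemma norm_mat_sqrt_mult_lower_bound:
  fixes A :: "real ^ 'n ^ 'n::finite"
  assumes "pos_def A"
  obtains s where "s > 0" "\<And>v. s * norm v \<le> norm (mat_sqrt A *v v)"
proof -
  obtain a where a: "a > 0" "\<And>v. a * (norm v)\<^sup>2 \<le> v \<bullet> (A *v v)"
    using pos_def_quadratic_lower_bound[OF assms] by blast
  show ?thesis
  proof
    show "sqrt a > 0" using a(1) by simp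
    show "sqrt a * norm v \<le> norm (mat_sqrt A *v v)" for v
    proof (rule power2_le_imp_le)
      show "(sqrt a * norm v)\<^sup>2 \<le> (norm (mat_sqrt A *v v))\<^sup>2"
        unfolding norm_mat_sqrt_mult[OF assms] using a by (simp add: power_mult_distrib)
    qed simp
  qed
qed

section \<open>Inner products of positive definite with positive semidefinite matrices\<close>

text \<open>Moving from \<open>v\<close> a distance proportional to \<open>t\<close> against
  \<open>L *v v\<close> changes the form from 0 to \<open>t\<^sup>2 * k - 2 * t * a\<close> with
  \<open>a\<close> the squared norm of \<open>L *v v\<close>; for small positive \<open>t\<close>
  this would be negative if \<open>a\<close> were positive.\<close>

lemma psd_mult_eq_0:
  assumes "psd L" "v \<bullet> (L *v v) = 0"
  shows "L *v v = 0"
proof -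
  define a where "a = (norm (L *v v))\<^sup>2"
  define k where "k = (L *v v) \<bullet> (L *v (L *v v))"
  have k: "k \<ge> 0" using assms(1) by (auto simp: k_def psd_def)
  have "v \<bullet> (L *v (L *v v)) = a"
    using assms(1) symmetric_inner_mult[of L v "L *v v"] by (simp add: a_def dot_square_norm psd_def)
  then have "(v - t *\<^sub>R (L *v v)) \<bullet> (L *v (v - t *\<^sub>R (L *v v))) = t\<^sup>2 * k - 2 * t * a" for t
    using assms(2)
    by (simp add: matrix_vector_mult_diff_distrib matrix_vector_mult_scaleR inner_simps k_def a_def
        dot_square_norm power2_eq_square algebra_simps)
  then have *: "0 \<le> t\<^sup>2 * k - 2 * t * a" for t
    using assms(1) unfolding psd_def by metis
  show ?thesis
  proof (rule ccontr)
    assume "L *v v \<noteq> 0"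
    then have a: "a > 0" by (simp add: a_def)
    \<comment> \<open>This gives \<open>t * k \<le> a\<close>, hence
      \<open>t * k - 2 * a < 0\<close>; the \<open>+ 1\<close> keeps the denominator positive when
      \<open>k = 0\<close>.\<close>
    define t where "t = a / (k + 1)"
    have "t > 0" "t * k \<le> a" using a k by (auto simp: t_def field_simps)
    then have "t * (t * k - 2 * a) < 0" using a by (intro mult_pos_neg) auto
    then show False using *[of t] by (simp add: power2_eq_square algebra_simps)
  qed
qed

text \<open>This is the identity of traces tr(S S L) = tr(S L S), with the right side written out as
  the forms of \<open>L\<close> at the rows of \<open>S\<close>.\<close>

lemma inner_square_eq_sum:
  fixes S L :: "real ^ 'n ^ 'n::finite"
  assumes "transpose S = S"
  shows "(S ** S) \<bullet> L = (\<Sum>k\<in>UNIV. S $ k \<bullet> (L *v S $ k))"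
proof -
  have sym: "S $ i $ j = S $ j $ i" for i j
    using assms by (metis transpose_def vec_lambda_beta)
  have "(S ** S) $ i $ j = (\<Sum>k\<in>UNIV. S $ k $ i * S $ k $ j)" for i j
    by (simp add: matrix_matrix_mult_def sym[of i])
  then have "(S ** S) \<bullet> L = (\<Sum>i\<in>UNIV. \<Sum>j\<in>UNIV. \<Sum>k\<in>UNIV. S $ k $ i * S $ k $ j * L $ i $ j)"
    by (simp add: inner_vec_def sum_distrib_right)
  also have "\<dots> = (\<Sum>i\<in>UNIV. \<Sum>k\<in>UNIV. \<Sum>j\<in>UNIV. S $ k $ i * S $ k $ j * L $ i $ j)"
    by (intro sum.cong refl sum.swap)
  also have "\<dots> = (\<Sum>k\<in>UNIV. \<Sum>i\<in>UNIV. \<Sum>j\<in>UNIV. S $ k $ i * S $ k $ j * L $ i $ j)"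
    by (rule sum.swap)
  also have "\<dots> = (\<Sum>k\<in>UNIV. S $ k \<bullet> (L *v S $ k))"
    by (simp add: inner_vec_def matrix_vector_mult_def sum_distrib_left mult_ac)
  finally show ?thesis .
qed

text \<open>With a square root \<open>S\<close> of \<open>A\<close>, the inner product is a sum of
  nonnegative forms of \<open>L\<close> at the rows of \<open>S\<close>. If it vanished,
  \<open>L\<close> would annihilate every row, so \<open>L ** S = 0\<close> and
  \<open>L ** A = 0\<close>, and invertibility of \<open>A\<close> would force
  \<open>L = 0\<close>.\<close>

lemma pos_def_inner_psd_pos:
  fixes A L :: "real ^ 'n ^ 'n::finite"
  assumes A: "pos_def A" and L: "psd L" "L \<noteq> 0"
  shows "A \<bullet> L > 0"
proof -
  have zero_left: "(0 :: real ^ 'n ^ 'n) ** B = 0" for B :: "real ^ 'n ^ 'n"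
    by (simp add: vec_eq_iff matrix_matrix_mult_def)
  obtain S where S: "psd S" "S ** S = A" using pos_def_sqrt_exists[OF A] by blast
  have symS: "transpose S = S" using S(1) by (simp add: psd_def)
  have eq: "A \<bullet> L = (\<Sum>k\<in>UNIV. S $ k \<bullet> (L *v S $ k))"
    using inner_square_eq_sum[OF symS, of L] S(2) by simp
  have nonneg: "S $ k \<bullet> (L *v S $ k) \<ge> 0" for k using L(1) by (simp add: psd_def)
  have "A \<bullet> L \<noteq> 0"
  proof
    assume "A \<bullet> L = 0"
    then have "\<forall>k\<in>UNIV. S $ k \<bullet> (L *v S $ k) = 0"
      unfolding eq using nonneg by (subst (asm) sum_nonneg_eq_0_iff) auto
    then have "L *v S $ k = 0" for k using psd_mult_eq_0[OF L(1)] by blast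
    moreover have "(L ** S) $ i $ j = (L *v S $ j) $ i" for i j
    proof -
      have "S $ k $ j = S $ j $ k" for k using symS by (metis transpose_def vec_lambda_beta)
      then show ?thesis by (simp add: matrix_matrix_mult_def matrix_vector_mult_def)
    qed
    ultimately have "L ** S = 0" by (simp add: vec_eq_iff)
    then have "L ** A = 0" by (metis S(2) matrix_mul_assoc zero_left)
    moreover have "A ** B = mat 1 \<Longrightarrow> L ** A = 0 \<Longrightarrow> L = 0" for B
      by (metis matrix_mul_assoc zero_left matrix_mul_rid)
    moreover have "\<exists>B. A ** B = mat 1"
    proof -
      have "A *v x = 0 \<longrightarrow> x = 0" for x
        using A unfolding pos_def_def by (metis inner_zero_right less_irrefl)
      then show ?thesis
        by (metis matrix_left_invertible_ker matrix_left_right_inverse)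
    qed
    ultimately show False using L(2) by blast
  qed
  then show ?thesis unfolding eq using nonneg by (simp add: sum_nonneg order.strict_iff_order)
qed

lemma closed_psd: "closed {L :: real ^ 'n ^ 'n::finite. psd L}"
proof -
  have tr: "continuous_on UNIV (\<lambda>L :: real ^ 'n ^ 'n. transpose L)"
    unfolding transpose_def by (intro continuous_intros continuous_on_vec_lambda)
  have quad: "continuous_on UNIV (\<lambda>L :: real ^ 'n ^ 'n. v \<bullet> (L *v v))" for v
    unfolding matrix_vector_mult_def by (intro continuous_intros continuous_on_vec_lambda)
  show ?thesis
    unfolding psd_def
    by (intro closed_Collect_conj closed_Collect_all closed_Collect_le closed_Collect_eq
        continuous_on_id continuous_on_const tr quad)
qed

text \<open>Positivity becomes a uniform bound by compactness of the positive semidefinite matrices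
  of norm 1, then by scaling. It makes the term with \<open>\<kappa>\<^sub>2\<close> coercive in
  \<open>\<Lambda>\<close>.\<close>

lemma pos_def_inner_psd_lower_bound:
  fixes A :: "real ^ 'n ^ 'n::finite"
  assumes A: "pos_def A"
  obtains c where "c > 0" "\<And>L. psd L \<Longrightarrow> c * norm L \<le> A \<bullet> L"
proof -
  define K where "K = {L :: real ^ 'n ^ 'n. psd L} \<inter> sphere 0 1"
  have K: "compact K" unfolding K_def by (intro closed_Int_compact closed_psd compact_sphere)
  have "\<exists>c>0. \<forall>L\<in>K. c \<le> A \<bullet> L"
  proof (cases "K = {}")
    case False
    have "continuous_on K (\<lambda>L. A \<bullet> L)" by (intro continuous_intros)
    then obtain L0 where L0: "L0 \<in> K" "\<forall>L\<in>K. A \<bullet> L0 \<le> A \<bullet> L"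
      using continuous_attains_inf[OF K False] by blast
    then have "A \<bullet> L0 > 0" by (intro pos_def_inner_psd_pos[OF A]) (auto simp: K_def)
    then show ?thesis using L0 by blast
  qed (auto intro: exI[of _ 1])
  then obtain c where c: "c > 0" "\<And>L. L \<in> K \<Longrightarrow> c \<le> A \<bullet> L" by blast
  show ?thesis
  proof (rule that[OF c(1)])
    fix L :: "real ^ 'n ^ 'n"
    assume L: "psd L"
    show "c * norm L \<le> A \<bullet> L"
    proof (cases "L = 0")
      case False
      have "transpose (t *\<^sub>R L) = t *\<^sub>R transpose L" for t
        by (simp add: transpose_def vec_eq_iff)
      then have "psd (L /\<^sub>R norm L)"
        using L by (simp add: psd_def flip: scaleR_matrix_vector_assoc)
      then have "L /\<^sub>R norm L \<in> K" using False by (simp add: K_def)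
      from c(2)[OF this] False show ?thesis by (simp add: field_simps)
    qed simp
  qed
qed

section \<open>Continuity and measurability of the objective and its optimal values\<close>

text \<open>The norm of a vector of vectors is the Frobenius norm, so the bound is the
  Cauchy-Schwarz inequality in each row.\<close>

lemma norm_matrix_vector_mult_le:
  fixes L :: "real ^ 'n ^ 'm::finite" and v :: "real ^ 'n::finite"
  shows "norm (L *v v) \<le> norm L * norm v"
proof -
  have "norm (L *v v) \<le> L2_set (\<lambda>i. norm (L $ i) * norm v) UNIV"
    unfolding norm_vec_def[of "L *v v"]
    by (intro L2_set_mono) (auto simp: matrix_vector_mul_component Cauchy_Schwarz_ineq2)
  also have "\<dots> = norm L * norm v"
    by (simp add: norm_vec_def[of L] L2_set_left_distrib)
  finally show ?thesis .
qed

lemma continuous_on_matrix_vector_mult [continuous_intros]: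
  fixes f :: "'a::topological_space \<Rightarrow> real ^ 'n::finite ^ 'm::finite"
  assumes "continuous_on S f" "continuous_on S g"
  shows "continuous_on S (\<lambda>x. f x *v g x)"
  unfolding matrix_vector_mult_def
  by (intro continuous_on_vec_lambda continuous_intros assms)

lemma continuous_on_transpose [continuous_intros]:
  fixes f :: "'a::topological_space \<Rightarrow> real ^ 'n::finite ^ 'm::finite"
  assumes "continuous_on S f"
  shows "continuous_on S (\<lambda>x. transpose (f x))"
  unfolding transpose_def by (intro continuous_on_vec_lambda continuous_intros assms)

lemma continuous_on_part [continuous_intros]:
  assumes "continuous_on S f"
  shows "continuous_on S (\<lambda>x. part_a (f x))" "continuous_on S (\<lambda>x. part_B (f x))"
  unfolding part_a_def part_B_def by (intro continuous_on_vec_lambda continuous_intros assms)+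

text \<open>A finite maximum of continuous functions at \<open>v\<close> is approximated by its
  values along a sequence from \<open>D\<close>. Replacing \<open>V\<close> by a countable
  \<open>D\<close> is what makes the infimum accessible to measurability arguments.\<close>

lemma INF_SUP_dense:
  fixes h :: "'i \<Rightarrow> 'v::metric_space \<Rightarrow> real"
  assumes "finite I" and cont: "\<And>i. i \<in> I \<Longrightarrow> continuous_on V (h i)"
    and D: "D \<subseteq> V" "V \<subseteq> closure D"
  shows "(INF v\<in>V. SUP i\<in>I. ereal (h i v)) = (INF v\<in>D. SUP i\<in>I. ereal (h i v))"
proof (rule antisym)
  show "(INF v\<in>V. SUP i\<in>I. ereal (h i v)) \<le> (INF v\<in>D. SUP i\<in>I. ereal (h i v))"
    by (rule INF_superset_mono) (use D in auto)
  show "(INF v\<in>D. SUP i\<in>I. ereal (h i v)) \<le> (INF v\<in>V. SUP i\<in>I. ereal (h i v))"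
  proof (rule INF_greatest)
    fix v assume v: "v \<in> V"
    then obtain d where d: "\<And>n. d n \<in> D" "d \<longlonglongrightarrow> v"
      using D(2) by (metis closure_sequential subsetD)
    show "(INF v\<in>D. SUP i\<in>I. ereal (h i v)) \<le> (SUP i\<in>I. ereal (h i v))"
    proof (rule ereal_le_epsilon2)
      fix e :: real assume e: "e > 0"
      \<comment> \<open>Finiteness of \<open>I\<close> yields one \<open>n\<close> that serves all
        indices.\<close>
      have "\<forall>\<^sub>F n in sequentially. \<forall>i\<in>I. h i (d n) < h i v + e"
      proof (rule eventually_ball_finite[OF \<open>finite I\<close>], rule ballI)
        fix i assume "i \<in> I"
        have "(\<lambda>n. h i (d n)) \<longlonglongrightarrow> h i v"
          by (rule continuous_on_tendsto_compose[OF cont[OF \<open>i \<in> I\<close>] d(2) v])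
            (use d(1) D(1) in \<open>auto intro!: always_eventually\<close>)
        then show "\<forall>\<^sub>F n in sequentially. h i (d n) < h i v + e"
          using e by (intro order_tendstoD) auto
      qed
      then obtain n where n: "\<And>i. i \<in> I \<Longrightarrow> h i (d n) < h i v + e"
        by (auto simp: eventually_sequentially)
      have "(INF v\<in>D. SUP i\<in>I. ereal (h i v)) \<le> (SUP i\<in>I. ereal (h i (d n)))"
        by (rule INF_lower[OF d(1)])
      also have "\<dots> \<le> (SUP i\<in>I. ereal (h i v)) + ereal e"
      proof (rule SUP_least)
        fix i assume i: "i \<in> I"
        have "ereal (h i (d n)) \<le> ereal (h i v) + ereal e" using n[OF i] by simp
        also have "\<dots> \<le> (SUP i\<in>I. ereal (h i v)) + ereal e"
          by (intro add_right_mono SUP_upper i)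
        finally show "ereal (h i (d n)) \<le> (SUP i\<in>I. ereal (h i v)) + ereal e" .
      qed
      finally show "(INF v\<in>D. SUP i\<in>I. ereal (h i v)) \<le> (SUP i\<in>I. ereal (h i v)) + ereal e" .
    qed
  qed
qed

lemma borel_measurable_INF_SUP_continuous:
  fixes h :: "'i \<Rightarrow> 'w \<Rightarrow> 'v::{metric_space,second_countable_topology} \<Rightarrow> real"
  assumes "finite I" and cont: "\<And>i \<omega>. i \<in> I \<Longrightarrow> continuous_on V (h i \<omega>)"
    and meas: "\<And>i v. i \<in> I \<Longrightarrow> v \<in> V \<Longrightarrow> (\<lambda>\<omega>. h i \<omega> v) \<in> borel_measurable M"
  shows "(\<lambda>\<omega>. INF v\<in>V. SUP i\<in>I. ereal (h i \<omega> v)) \<in> borel_measurable M"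
proof -
  obtain D where D: "countable D" "D \<subseteq> V" "V \<subseteq> closure D" using separable by blast
  have "(\<lambda>\<omega>. INF v\<in>D. SUP i\<in>I. ereal (h i \<omega> v)) \<in> borel_measurable M"
    using D \<open>finite I\<close> by (intro borel_measurable_INF borel_measurable_SUP borel_measurable_ereal meas)
      (auto intro: countable_finite)
  moreover have "(INF v\<in>V. SUP i\<in>I. ereal (h i \<omega> v)) = (INF v\<in>D. SUP i\<in>I. ereal (h i \<omega> v))" for \<omega>
    by (rule INF_SUP_dense[OF \<open>finite I\<close> cont D(2,3)])
  ultimately show ?thesis by simp
qed

lemma continuous_on_h_fun:
  assumes "continuous_on UNIV \<psi>"
  shows "continuous_on S (h_fun \<psi> \<mu> \<Sigma> \<kappa>\<^sub>1 \<kappa>\<^sub>2 \<tau>\<^sub>1 \<tau>\<^sub>2 \<beta> \<xi>)"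
    and "continuous_on S' (\<lambda>\<xi>. h_fun \<psi> \<mu> \<Sigma> \<kappa>\<^sub>1 \<kappa>\<^sub>2 \<tau>\<^sub>1 \<tau>\<^sub>2 \<beta> \<xi> \<nu>)"
proof -
  have psi: "continuous_on A (\<lambda>x. \<psi> (f x))" if "continuous_on A f" for A f
    by (rule continuous_on_compose2[OF assms that]) simp
  \<comment> \<open>The defining equations match on tuples; writing \<open>\<nu>\<close> through its
    projections lets them unfold under the abstraction.\<close>
  have eq: "h_fun \<psi> \<mu> \<Sigma> \<kappa>\<^sub>1 \<kappa>\<^sub>2 \<tau>\<^sub>1 \<tau>\<^sub>2 \<beta> \<xi> = (\<lambda>\<nu>. h_fun \<psi> \<mu> \<Sigma> \<kappa>\<^sub>1 \<kappa>\<^sub>2 \<tau>\<^sub>1 \<tau>\<^sub>2 \<beta> \<xi>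
      (fst \<nu>, fst (snd \<nu>), fst (snd (snd \<nu>)), snd (snd (snd \<nu>))))"
    by simp
  show "continuous_on S (h_fun \<psi> \<mu> \<Sigma> \<kappa>\<^sub>1 \<kappa>\<^sub>2 \<tau>\<^sub>1 \<tau>\<^sub>2 \<beta> \<xi>)"
    by (subst eq, unfold h_fun_def h1.simps h2.simps h_mid.simps) (intro continuous_intros psi)
  show "continuous_on S' (\<lambda>\<xi>. h_fun \<psi> \<mu> \<Sigma> \<kappa>\<^sub>1 \<kappa>\<^sub>2 \<tau>\<^sub>1 \<tau>\<^sub>2 \<beta> \<xi> \<nu>)"
    by (cases \<nu>) (simp only: h_fun_def h1.simps h2.simps h_mid.simps, intro continuous_intros psi)
qed

section \<open>The objective centered at the mean, and the simplex\<close>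

text \<open>Expanding the quadratic part of \<open>h1\<close> and \<open>h2\<close> around
  \<open>\<mu>\<close> leaves, as coefficient of the linear term, the very vector \<open>p\<close>
  whose norm is penalized in \<open>h_mid\<close>; so the penalty controls the linear term.\<close>

lemma h_fun_centered:
  fixes \<mu> q :: "real ^ ('d::finite option)" and \<Lambda> :: "real ^ ('d option) ^ ('d option)"
  assumes "transpose \<Lambda> = \<Lambda>"
  defines "p \<equiv> q + 2 *\<^sub>R (\<Lambda> *v \<mu>)"
  shows "h_fun \<psi> \<mu> \<Sigma> \<kappa>\<^sub>1 \<kappa>\<^sub>2 \<tau>\<^sub>1 \<tau>\<^sub>2 \<beta> \<xi> (x, \<alpha>, q, \<Lambda>) =
    \<kappa>\<^sub>2 * (\<Sigma> \<bullet> \<Lambda>) + sqrt \<kappa>\<^sub>1 * norm (mat_sqrt \<Sigma> *v p) + \<tau>\<^sub>1 * (norm x)\<^sup>2 + \<tau>\<^sub>2 * \<alpha>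
    + (\<psi> (part_a \<xi> - part_B \<xi> \<bullet> x) - (\<xi> - \<mu>) \<bullet> (\<Lambda> *v (\<xi> - \<mu>)) - p \<bullet> (\<xi> - \<mu>))
    + \<tau>\<^sub>2 / (1 - \<beta>) * max (- (x \<bullet> part_B \<xi>) - \<alpha>) 0"
proof -
  have "(\<Lambda> *v \<mu> + q) \<bullet> \<mu> - (\<Lambda> *v \<xi> + q) \<bullet> \<xi> = - ((\<xi> - \<mu>) \<bullet> (\<Lambda> *v (\<xi> - \<mu>))) - p \<bullet> (\<xi> - \<mu>)"
    using symmetric_inner_mult[OF assms(1), of \<mu> \<xi>]
    by (simp add: p_def matrix_vector_mult_diff_distrib inner_simps inner_commute algebra_simps)
  then show ?thesis using assms(1) by (simp add: h_fun_def p_def)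
qed

lemma compact_unit_simplex: "compact (unit_simplex :: (real ^ 'd::finite) set)"
proof -
  have "norm x \<le> 1" if "x \<in> unit_simplex" for x :: "real ^ 'd"
    using norm_le_l1_cart[of x] that by (simp add: unit_simplex_def)
  then have "bounded (unit_simplex :: (real ^ 'd) set)" by (auto simp: bounded_iff)
  moreover have "closed (unit_simplex :: (real ^ 'd) set)"
    unfolding unit_simplex_def
    by (intro closed_Collect_conj closed_Collect_all closed_Collect_le closed_Collect_eq
        continuous_intros)
  ultimately show ?thesis by (simp add: compact_eq_bounded_closed)
qed

lemma unit_simplex_nonempty: "(\<chi> i. 1 / real CARD('d)) \<in> (unit_simplex :: (real ^ 'd::finite) set)"
  by (simp add: unit_simplex_def)

lemma sample_mean_in_convex:
  assumes "convex S" "m \<ge> 1" "\<And>k. k < m \<Longrightarrow> obs k \<in> S"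
  shows "sample_mean m obs \<in> S"
proof -
  have "(\<Sum>k<m. (1 / real m) *\<^sub>R obs k) \<in> S"
    by (rule convex_sum) (use assms in auto)
  then show ?thesis by (simp add: sample_mean_def scaleR_sum_right)
qed

section \<open>Probability that the sample misses a ball\<close>

text \<open>By independence, all N samples avoid a given ball with probability at most
  \<open>(1 - p)\<close> to the power N, which is at most \<open>exp (- p * real N)\<close>; a union
  bound over the centers in \<open>Z\<close> follows.\<close>

lemma (in prob_space) prob_ex_ball_without_sample:
  fixes X :: "nat \<Rightarrow> 'a \<Rightarrow> 'b::{real_normed_vector,second_countable_topology}"
  assumes indep: "indep_vars (\<lambda>_. restrict_space borel S) X {1..}"
    and distr: "\<And>i. i \<ge> 1 \<Longrightarrow> distr M (restrict_space borel S) (X i) = P"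
    and Z: "finite Z" "\<And>z. z \<in> Z \<Longrightarrow> p \<le> measure P {y \<in> S. norm (y - z) < r}"
    and N: "N \<ge> 1"
  defines "E \<equiv> {\<omega> \<in> space M. \<exists>z\<in>Z. \<forall>i\<in>{1..N}. \<not> norm (X i \<omega> - z) < r}"
  shows "E \<in> events" "prob E \<le> real (card Z) * exp (- p * real N)"
proof -
  define A where "A z = {y \<in> S. norm (y - z) < r}" for z
  have A: "A z \<in> sets (restrict_space borel S)" for z
  proof -
    have "A z = S \<inter> ball z r" by (auto simp: A_def dist_norm norm_minus_commute)
    then show ?thesis by (auto simp: sets_restrict_space)
  qed
  have SA: "S - A z \<in> sets (restrict_space borel S)" for z
    using sets.compl_sets[OF A[of z]] by (simp add: space_restrict_space)
  have X: "X i \<in> measurable M (restrict_space borel S)" if "i \<ge> 1" for i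
    using indep that by (auto simp: indep_vars_def)
  have XS: "X i \<omega> \<in> S" if "i \<ge> 1" "\<omega> \<in> space M" for i \<omega>
    using measurable_space[OF X[OF that(1)] that(2)] by (simp add: space_restrict_space)
  define F where "F z = (\<Inter>i\<in>{1..N}. X i -` (S - A z) \<inter> space M)" for z
  have F: "F z \<in> events" for z
    unfolding F_def using N X SA by (intro sets.finite_INT measurable_sets) auto
  have E: "E = (\<Union>z\<in>Z. F z)"
    using N XS by (fastforce simp: E_def F_def A_def)
  show "E \<in> events" unfolding E using Z(1) F by blast
  have prob_F: "prob (F z) \<le> exp (- p * real N)" if z: "z \<in> Z" for z
  proof -
    have "prob (X i -` (S - A z) \<inter> space M) \<le> exp (- p)" if i: "i \<in> {1..N}" for i
    proof -
      have "X i -` (S - A z) \<inter> space M = space M - (X i -` A z \<inter> space M)"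
        using XS i by auto
      then have "prob (X i -` (S - A z) \<inter> space M) = 1 - prob (X i -` A z \<inter> space M)"
        using i X A by (simp add: prob_compl measurable_sets)
      also have "prob (X i -` A z \<inter> space M) = measure P (A z)"
        using i X A measure_distr[of "X i" M "restrict_space borel S" "A z"] distr[of i] by simp
      also have "1 - \<dots> \<le> 1 + (- p)" using Z(2)[OF z] by (simp add: A_def)
      also have "\<dots> \<le> exp (- p)" by (rule exp_ge_add_one_self)
      finally show ?thesis .
    qed
    then have "(\<Prod>i\<in>{1..N}. prob (X i -` (S - A z) \<inter> space M)) \<le> (\<Prod>i\<in>{1..N}. exp (- p))"
      by (intro prod_mono) auto
    moreover have "prob (F z) = (\<Prod>i\<in>{1..N}. prob (X i -` (S - A z) \<inter> space M))"
      unfolding F_def by (rule indep_varsD[OF indep]) (use N SA in auto)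
    ultimately show ?thesis by (simp add: exp_of_nat_mult[symmetric] mult.commute)
  qed
  have "prob E \<le> (\<Sum>z\<in>Z. prob (F z))"
    unfolding E using Z(1) F by (intro finite_measure_subadditive_finite) auto
  also have "\<dots> \<le> (\<Sum>z\<in>Z. exp (- p * real N))" by (intro sum_mono prob_F)
  finally show "prob E \<le> real (card Z) * exp (- p * real N)" by simp
qed

section \<open>Coercivity and equicontinuity of the objective\<close>

text \<open>The penalties dominate \<open>2 * a\<close> times the norms of \<open>\<Lambda>\<close>
  and \<open>p\<close>, while the terms in \<open>\<xi> - \<mu>\<close> cost at most
  \<open>a\<close> times these norms when \<open>\<xi>\<close> is near \<open>\<mu>\<close>. The
  remaining terms are bounded below uniformly in \<open>x\<close> and
  \<open>\<alpha>\<close>.\<close>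

lemma h_fun_lower_bound_near_mean:
  fixes \<Xi> :: "(real ^ ('d::finite option)) set"
  assumes Xi: "compact \<Xi>" "\<mu> \<in> \<Xi>" and Sigma: "pos_def \<Sigma>" and psi: "continuous_on UNIV \<psi>"
    and params: "\<tau>\<^sub>1 \<ge> 0" "\<tau>\<^sub>2 \<ge> 0" "0 < \<beta>" "\<beta> < 1" "\<kappa>\<^sub>1 > 0" "\<kappa>\<^sub>2 > 0"
  obtains a b where "a > 0"
    "\<And>\<xi> x \<alpha> q \<Lambda>. \<xi> \<in> \<Xi> \<Longrightarrow> norm (\<xi> - \<mu>) < min 1 a \<Longrightarrow> (x, \<alpha>, q, \<Lambda>) \<in> feasible_set \<Longrightarrow>
      a * norm \<Lambda> + a * norm (q + 2 *\<^sub>R (\<Lambda> *v \<mu>)) - b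
        \<le> h_fun \<psi> \<mu> \<Sigma> \<kappa>\<^sub>1 \<kappa>\<^sub>2 \<tau>\<^sub>1 \<tau>\<^sub>2 \<beta> \<xi> (x, \<alpha>, q, \<Lambda>)"
proof -
  obtain c where c: "c > 0" "\<And>L. psd L \<Longrightarrow> c * norm L \<le> \<Sigma> \<bullet> L"
    using pos_def_inner_psd_lower_bound[OF Sigma] by blast
  obtain s where s: "s > 0" "\<And>v. s * norm v \<le> norm (mat_sqrt \<Sigma> *v v)"
    using norm_mat_sqrt_mult_lower_bound[OF Sigma] by blast
  have comp: "compact (\<Xi> \<times> unit_simplex)" by (intro compact_Times Xi compact_unit_simplex)
  have "continuous_on (\<Xi> \<times> unit_simplex) (\<lambda>y. \<psi> (part_a (fst y) - part_B (fst y) \<bullet> snd y))"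
    by (intro continuous_on_compose2[OF psi] continuous_intros) auto
  from compact_continuous_image[OF this comp] have
    "bounded ((\<lambda>y. \<psi> (part_a (fst y) - part_B (fst y) \<bullet> snd y)) ` (\<Xi> \<times> unit_simplex))"
    by (rule compact_imp_bounded)
  then obtain B1 where
    "\<forall>\<xi>\<in>\<Xi>. \<forall>x\<in>unit_simplex. \<bar>\<psi> (part_a \<xi> - part_B \<xi> \<bullet> x)\<bar> \<le> B1"
    by (auto simp: bounded_iff)
  then have B1: "- B1 \<le> \<psi> (part_a \<xi> - part_B \<xi> \<bullet> x)" if "\<xi> \<in> \<Xi>" "x \<in> unit_simplex" for \<xi> x
    using that by fastforce
  have "continuous_on (\<Xi> \<times> unit_simplex) (\<lambda>y. snd y \<bullet> part_B (fst y))"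
    by (intro continuous_intros)
  from compact_continuous_image[OF this comp] have
    "bounded ((\<lambda>y. snd y \<bullet> part_B (fst y)) ` (\<Xi> \<times> unit_simplex))"
    by (rule compact_imp_bounded)
  then obtain B2 where "\<forall>\<xi>\<in>\<Xi>. \<forall>x\<in>unit_simplex. \<bar>x \<bullet> part_B \<xi>\<bar> \<le> B2"
    by (auto simp: bounded_iff)
  then have B2: "x \<bullet> part_B \<xi> \<le> B2" if "\<xi> \<in> \<Xi>" "x \<in> unit_simplex" for \<xi> x
    using that by fastforce
  define a where "a = min (\<kappa>\<^sub>2 * c) (sqrt \<kappa>\<^sub>1 * s) / 2"
  have a: "a > 0" "2 * a \<le> \<kappa>\<^sub>2 * c" "2 * a \<le> sqrt \<kappa>\<^sub>1 * s"
    using params c(1) s(1) by (auto simp: a_def)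
  show ?thesis
  proof (rule that[OF a(1)])
    fix \<xi> and x :: "real ^ 'd" and \<alpha> q \<Lambda>
    assume \<xi>: "\<xi> \<in> \<Xi>" "norm (\<xi> - \<mu>) < min 1 a" and nu: "(x, \<alpha>, q, \<Lambda>) \<in> feasible_set"
    define p where "p = q + 2 *\<^sub>R (\<Lambda> *v \<mu>)"
    define y where "y = \<xi> - \<mu>"
    have L: "psd \<Lambda>" "transpose \<Lambda> = \<Lambda>" and x: "x \<in> unit_simplex"
      using nu by (auto simp: feasible_set_def psd_def)
    have y: "norm y \<le> 1" "norm y \<le> a" using \<xi> by (auto simp: y_def)
    have "y \<bullet> (\<Lambda> *v y) \<le> norm y * (norm \<Lambda> * norm y)"
      by (rule order_trans[OF norm_cauchy_schwarz])
        (intro mult_left_mono norm_matrix_vector_mult_le norm_ge_zero)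
    \<comment> \<open>One factor \<open>norm y\<close> is bounded by \<open>a\<close>, the other by
      1; hence the radius \<open>min 1 a\<close>.\<close>
    also have "\<dots> \<le> a * (norm \<Lambda> * 1)" using y a(1) by (intro mult_mono mult_left_mono) auto
    finally have quad: "y \<bullet> (\<Lambda> *v y) \<le> a * norm \<Lambda>" by simp
    have "p \<bullet> y \<le> norm p * norm y" by (rule norm_cauchy_schwarz)
    also have "\<dots> \<le> a * norm p"
      by (subst mult.commute) (intro mult_right_mono y norm_ge_zero)
    finally have lin: "p \<bullet> y \<le> a * norm p" .
    have "2 * a * norm \<Lambda> \<le> \<kappa>\<^sub>2 * c * norm \<Lambda>" using a by (intro mult_right_mono) auto
    also have "\<dots> \<le> \<kappa>\<^sub>2 * (\<Sigma> \<bullet> \<Lambda>)" using c(2)[OF L(1)] params by (simp add: mult.assoc)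
    finally have L_bound: "2 * a * norm \<Lambda> \<le> \<kappa>\<^sub>2 * (\<Sigma> \<bullet> \<Lambda>)" .
    have "2 * a * norm p \<le> sqrt \<kappa>\<^sub>1 * s * norm p" using a by (intro mult_right_mono) auto
    also have "\<dots> \<le> sqrt \<kappa>\<^sub>1 * norm (mat_sqrt \<Sigma> *v p)"
      using s(2)[of p] params by (simp add: mult.assoc)
    finally have p_bound: "2 * a * norm p \<le> sqrt \<kappa>\<^sub>1 * norm (mat_sqrt \<Sigma> *v p)" .
    \<comment> \<open>Since \<open>1 / (1 - \<beta>) \<ge> 1\<close>, the positive part outweighs
      \<open>\<tau>\<^sub>2 * \<alpha>\<close> as \<alpha> tends to minus infinity: together they
      are at least \<open>- \<tau>\<^sub>2 * B2\<close>, whatever \<alpha> is.\<close>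
    have "\<tau>\<^sub>2 * max (- (x \<bullet> part_B \<xi>) - \<alpha>) 0 \<le> \<tau>\<^sub>2 / (1 - \<beta>) * max (- (x \<bullet> part_B \<xi>) - \<alpha>) 0"
      using params mult_left_mono[of "1 - \<beta>" 1 \<tau>\<^sub>2]
      by (intro mult_right_mono) (auto simp: pos_le_divide_eq)
    moreover have "\<tau>\<^sub>2 * (- B2 - \<alpha>) \<le> \<tau>\<^sub>2 * max (- (x \<bullet> part_B \<xi>) - \<alpha>) 0"
      using B2[OF \<xi>(1) x] params by (intro mult_left_mono) auto
    moreover have "0 \<le> \<tau>\<^sub>1 * (norm x)\<^sup>2" using params by simp
    ultimately show "a * norm \<Lambda> + a * norm (q + 2 *\<^sub>R (\<Lambda> *v \<mu>)) - (B1 + \<tau>\<^sub>2 * B2)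
        \<le> h_fun \<psi> \<mu> \<Sigma> \<kappa>\<^sub>1 \<kappa>\<^sub>2 \<tau>\<^sub>1 \<tau>\<^sub>2 \<beta> \<xi> (x, \<alpha>, q, \<Lambda>)"
      unfolding h_fun_centered[OF L(2)] p_def[symmetric] y_def[symmetric]
      using B1[OF \<xi>(1) x] quad lin L_bound p_bound by (simp add: algebra_simps)
  qed
qed

text \<open>The part \<open>F\<close> without \<alpha> is uniformly continuous on a compact set of
  arguments. The variable \<alpha> ranges over an unbounded set, but the positive part is
  1-Lipschitz in its argument, so uniform continuity of \<open>G\<close> gives a modulus valid for
  all \<alpha>.\<close>

lemma h_fun_uniformly_continuous:
  fixes \<Xi> :: "(real ^ ('d::finite option)) set"
  assumes Xi: "compact \<Xi>" and psi: "continuous_on UNIV \<psi>"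
    and params: "\<tau>\<^sub>2 \<ge> 0" "\<beta> < 1" and e: "e > 0"
  obtains \<delta> where "\<delta> > 0"
    "\<And>\<xi> \<xi>' x \<alpha> q \<Lambda>. \<xi> \<in> \<Xi> \<Longrightarrow> \<xi>' \<in> \<Xi> \<Longrightarrow> norm (\<xi>' - \<xi>) < \<delta> \<Longrightarrow> (x, \<alpha>, q, \<Lambda>) \<in> feasible_set \<Longrightarrow>
      norm \<Lambda> \<le> R \<Longrightarrow> norm (q + 2 *\<^sub>R (\<Lambda> *v \<mu>)) \<le> R \<Longrightarrow>
      h_fun \<psi> \<mu> \<Sigma> \<kappa>\<^sub>1 \<kappa>\<^sub>2 \<tau>\<^sub>1 \<tau>\<^sub>2 \<beta> \<xi> (x, \<alpha>, q, \<Lambda>)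
        \<le> h_fun \<psi> \<mu> \<Sigma> \<kappa>\<^sub>1 \<kappa>\<^sub>2 \<tau>\<^sub>1 \<tau>\<^sub>2 \<beta> \<xi>' (x, \<alpha>, q, \<Lambda>) + e"
proof -
  define F :: "(real ^ ('d option)) \<times> (real ^ 'd) \<times> (real ^ ('d option)) \<times> (real ^ ('d option) ^ ('d option)) \<Rightarrow> real"
    where "F = (\<lambda>(\<xi>, x, p, \<Lambda>). \<psi> (part_a \<xi> - part_B \<xi> \<bullet> x)
      - (\<xi> - \<mu>) \<bullet> (\<Lambda> *v (\<xi> - \<mu>)) - p \<bullet> (\<xi> - \<mu>))"
  define G :: "(real ^ ('d option)) \<times> (real ^ 'd) \<Rightarrow> real" where "G = (\<lambda>(\<xi>, x). x \<bullet> part_B \<xi>)"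
  define K where "K = \<Xi> \<times> (unit_simplex :: (real ^ 'd) set) \<times> cball (0 :: real ^ ('d option)) R
    \<times> cball (0 :: real ^ ('d option) ^ ('d option)) R"
  \<comment> \<open>Chosen so that the positive part, with its coefficient, contributes at most
    \<open>e / 2\<close>; the \<open>+ 1\<close> avoids division by zero when
    \<open>\<tau>\<^sub>2 = 0\<close>.\<close>
  define e' where "e' = e * (1 - \<beta>) / (2 * (\<tau>\<^sub>2 + 1))"
  have "\<tau>\<^sub>2 / (1 - \<beta>) * e' = \<tau>\<^sub>2 / (\<tau>\<^sub>2 + 1) * (e / 2)"
    using params by (simp add: e'_def)
  also have "\<dots> \<le> 1 * (e / 2)" using e params by (intro mult_right_mono) auto
  finally have e': "e' > 0" "\<tau>\<^sub>2 / (1 - \<beta>) * e' \<le> e / 2"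
    using e params by (auto simp: e'_def)
  have "compact K"
    unfolding K_def by (intro compact_Times Xi compact_unit_simplex compact_cball)
  moreover have "continuous_on K F"
    unfolding F_def case_prod_unfold
    by (intro continuous_on_compose2[OF psi] continuous_intros) auto
  ultimately have "uniformly_continuous_on K F" by (intro compact_uniformly_continuous)
  then obtain d1 where d1: "d1 > 0" "\<And>u v. u \<in> K \<Longrightarrow> v \<in> K \<Longrightarrow> dist v u < d1 \<Longrightarrow> dist (F v) (F u) < e / 2"
    using e unfolding uniformly_continuous_on_def by (meson half_gt_zero)
  have "compact (\<Xi> \<times> (unit_simplex :: (real ^ 'd) set))"
    by (intro compact_Times Xi compact_unit_simplex)
  moreover have "continuous_on (\<Xi> \<times> unit_simplex) G"
    unfolding G_def case_prod_unfold by (intro continuous_intros)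
  ultimately have "uniformly_continuous_on (\<Xi> \<times> unit_simplex) G"
    by (intro compact_uniformly_continuous)
  then obtain d2 where d2: "d2 > 0" "\<And>u v. u \<in> \<Xi> \<times> unit_simplex \<Longrightarrow> v \<in> \<Xi> \<times> unit_simplex \<Longrightarrow>
      dist v u < d2 \<Longrightarrow> dist (G v) (G u) < e'"
    using e'(1) unfolding uniformly_continuous_on_def by meson
  show ?thesis
  proof (rule that[of "min d1 d2"])
    show "min d1 d2 > 0" using d1 d2 by simp
    fix \<xi> \<xi>' and x :: "real ^ 'd" and \<alpha> q \<Lambda>
    assume \<xi>: "\<xi> \<in> \<Xi>" "\<xi>' \<in> \<Xi>" "norm (\<xi>' - \<xi>) < min d1 d2"
      and nu: "(x, \<alpha>, q, \<Lambda>) \<in> feasible_set"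
      and R: "norm \<Lambda> \<le> R" "norm (q + 2 *\<^sub>R (\<Lambda> *v \<mu>)) \<le> R"
    define p where "p = q + 2 *\<^sub>R (\<Lambda> *v \<mu>)"
    have L: "transpose \<Lambda> = \<Lambda>" and x: "x \<in> unit_simplex"
      using nu by (auto simp: feasible_set_def psd_def)
    have "dist (F (\<xi>', x, p, \<Lambda>)) (F (\<xi>, x, p, \<Lambda>)) < e / 2"
      by (rule d1(2)) (use \<xi> x R[folded p_def] in \<open>auto simp: K_def dist_Pair_Pair dist_norm\<close>)
    then have 1: "F (\<xi>, x, p, \<Lambda>) \<le> F (\<xi>', x, p, \<Lambda>) + e / 2"
      unfolding dist_real_def by linarith
    have "dist (G (\<xi>', x)) (G (\<xi>, x)) < e'"
      by (rule d2(2)) (use \<xi> x in \<open>auto simp: dist_Pair_Pair dist_norm\<close>)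
    then have "max (- (x \<bullet> part_B \<xi>) - \<alpha>) 0 \<le> max (- (x \<bullet> part_B \<xi>') - \<alpha>) 0 + e'"
      by (auto simp: G_def dist_real_def)
    then have "\<tau>\<^sub>2 / (1 - \<beta>) * max (- (x \<bullet> part_B \<xi>) - \<alpha>) 0
        \<le> \<tau>\<^sub>2 / (1 - \<beta>) * (max (- (x \<bullet> part_B \<xi>') - \<alpha>) 0 + e')"
      using params by (intro mult_left_mono) auto
    also have "\<dots> \<le> \<tau>\<^sub>2 / (1 - \<beta>) * max (- (x \<bullet> part_B \<xi>') - \<alpha>) 0 + e / 2"
      using e'(2) by (simp only: distrib_left)
    finally show "h_fun \<psi> \<mu> \<Sigma> \<kappa>\<^sub>1 \<kappa>\<^sub>2 \<tau>\<^sub>1 \<tau>\<^sub>2 \<beta> \<xi> (x, \<alpha>, q, \<Lambda>)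
        \<le> h_fun \<psi> \<mu> \<Sigma> \<kappa>\<^sub>1 \<kappa>\<^sub>2 \<tau>\<^sub>1 \<tau>\<^sub>2 \<beta> \<xi>' (x, \<alpha>, q, \<Lambda>) + e"
      using 1 unfolding h_fun_centered[OF L] p_def[symmetric] F_def case_prod_conv by linarith
  qed
qed

section \<open>Finiteness and stability of the optimal values\<close>

text \<open>From below, every supremum is at least the value at \<open>\<mu>\<close>, which
  coercivity bounds by \<open>- b\<close>; from above, one feasible point suffices, the barycenter
  of the simplex with zeros elsewhere.\<close>

lemma opt_value_finite:
  fixes \<Xi> :: "(real ^ ('d::finite option)) set"
  assumes Xi: "compact \<Xi>" "\<mu> \<in> \<Xi>" and Sigma: "pos_def \<Sigma>" and psi: "continuous_on UNIV \<psi>"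
    and params: "\<tau>\<^sub>1 \<ge> 0" "\<tau>\<^sub>2 \<ge> 0" "0 < \<beta>" "\<beta> < 1" "\<kappa>\<^sub>1 > 0" "\<kappa>\<^sub>2 > 0"
  obtains \<theta> where "opt_value \<psi> \<mu> \<Sigma> \<kappa>\<^sub>1 \<kappa>\<^sub>2 \<tau>\<^sub>1 \<tau>\<^sub>2 \<beta> \<Xi> = ereal \<theta>"
proof -
  let ?h = "h_fun \<psi> \<mu> \<Sigma> \<kappa>\<^sub>1 \<kappa>\<^sub>2 \<tau>\<^sub>1 \<tau>\<^sub>2 \<beta>"
  obtain a b where ab: "a > 0" "\<And>\<xi> x \<alpha> q \<Lambda>. \<xi> \<in> \<Xi> \<Longrightarrow> norm (\<xi> - \<mu>) < min 1 a \<Longrightarrow>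
      (x, \<alpha>, q, \<Lambda>) \<in> feasible_set \<Longrightarrow>
      a * norm \<Lambda> + a * norm (q + 2 *\<^sub>R (\<Lambda> *v \<mu>)) - b \<le> ?h \<xi> (x, \<alpha>, q, \<Lambda>)"
    using h_fun_lower_bound_near_mean[OF assms] by blast
  have "ereal (- b) \<le> (SUP \<xi>\<in>\<Xi>. ereal (?h \<xi> \<nu>))" if nu: "\<nu> \<in> feasible_set" for \<nu>
  proof -
    obtain x \<alpha> q \<Lambda> where \<nu>: "\<nu> = (x, \<alpha>, q, \<Lambda>)" by (metis prod.exhaust)
    have "0 \<le> a * norm \<Lambda> + a * norm (q + 2 *\<^sub>R (\<Lambda> *v \<mu>))" using ab(1) by simp
    moreover have "a * norm \<Lambda> + a * norm (q + 2 *\<^sub>R (\<Lambda> *v \<mu>)) - b \<le> ?h \<mu> \<nu>"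
      unfolding \<nu> by (rule ab(2)) (use nu \<nu> Xi(2) ab(1) in auto)
    ultimately have "- b \<le> ?h \<mu> \<nu>" by linarith
    then show ?thesis by (intro SUP_upper2[OF Xi(2)]) simp
  qed
  then have lower: "ereal (- b) \<le> opt_value \<psi> \<mu> \<Sigma> \<kappa>\<^sub>1 \<kappa>\<^sub>2 \<tau>\<^sub>1 \<tau>\<^sub>2 \<beta> \<Xi>"
    unfolding opt_value_def by (intro INF_greatest)
  define \<nu>0 :: "'d dual_var" where "\<nu>0 = (\<chi> i. 1 / real CARD('d), 0, 0, 0)"
  have nu0: "\<nu>0 \<in> feasible_set"
    using unit_simplex_nonempty[where 'd = 'd]
    by (simp add: \<nu>0_def feasible_set_def psd_def transpose_def vec_eq_iff)
  have "bounded ((\<lambda>\<xi>. ?h \<xi> \<nu>0) ` \<Xi>)"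
    by (intro compact_imp_bounded compact_continuous_image Xi continuous_on_h_fun psi)
  then obtain u where "\<And>\<xi>. \<xi> \<in> \<Xi> \<Longrightarrow> ?h \<xi> \<nu>0 \<le> u"
    unfolding bounded_iff by (auto simp: abs_le_iff)
  then have "(SUP \<xi>\<in>\<Xi>. ereal (?h \<xi> \<nu>0)) \<le> ereal u" by (intro SUP_least) simp
  then have "opt_value \<psi> \<mu> \<Sigma> \<kappa>\<^sub>1 \<kappa>\<^sub>2 \<tau>\<^sub>1 \<tau>\<^sub>2 \<beta> \<Xi> \<le> ereal u"
    unfolding opt_value_def by (rule INF_lower2[OF nu0])
  with lower show ?thesis
    by (cases "opt_value \<psi> \<mu> \<Sigma> \<kappa>\<^sub>1 \<kappa>\<^sub>2 \<tau>\<^sub>1 \<tau>\<^sub>2 \<beta> \<Xi>") (auto intro: that)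
qed

text \<open>Passing to a subset can only lower the value. Conversely, a \<open>\<nu>\<close> whose
  supremum over \<open>X\<close> is at most \<open>\<theta> + 1\<close> has bounded
  \<open>\<Lambda>\<close> and \<open>p\<close>, so equicontinuity transfers its supremum from
  \<open>\<Xi>\<close> to \<open>X\<close> at a cost of \<open>e / 2\<close>.\<close>

lemma opt_value_net_stability:
  fixes \<Xi> :: "(real ^ ('d::finite option)) set"
  assumes Xi: "compact \<Xi>" "\<mu> \<in> \<Xi>" and Sigma: "pos_def \<Sigma>" and psi: "continuous_on UNIV \<psi>"
    and params: "\<tau>\<^sub>1 \<ge> 0" "\<tau>\<^sub>2 \<ge> 0" "0 < \<beta>" "\<beta> < 1" "\<kappa>\<^sub>1 > 0" "\<kappa>\<^sub>2 > 0"
    and e: "e > 0"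
  obtains \<delta> where "\<delta> > 0"
    "\<And>X. X \<subseteq> \<Xi> \<Longrightarrow> (\<And>z. z \<in> \<Xi> \<Longrightarrow> \<exists>y\<in>X. norm (y - z) < \<delta>) \<Longrightarrow>
      \<bar>opt_value \<psi> \<mu> \<Sigma> \<kappa>\<^sub>1 \<kappa>\<^sub>2 \<tau>\<^sub>1 \<tau>\<^sub>2 \<beta> X - opt_value \<psi> \<mu> \<Sigma> \<kappa>\<^sub>1 \<kappa>\<^sub>2 \<tau>\<^sub>1 \<tau>\<^sub>2 \<beta> \<Xi>\<bar> < ereal e"
proof -
  let ?h = "h_fun \<psi> \<mu> \<Sigma> \<kappa>\<^sub>1 \<kappa>\<^sub>2 \<tau>\<^sub>1 \<tau>\<^sub>2 \<beta>"
  let ?opt = "opt_value \<psi> \<mu> \<Sigma> \<kappa>\<^sub>1 \<kappa>\<^sub>2 \<tau>\<^sub>1 \<tau>\<^sub>2 \<beta>"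
  obtain a b where ab: "a > 0" "\<And>\<xi> x \<alpha> q \<Lambda>. \<xi> \<in> \<Xi> \<Longrightarrow> norm (\<xi> - \<mu>) < min 1 a \<Longrightarrow>
      (x, \<alpha>, q, \<Lambda>) \<in> feasible_set \<Longrightarrow>
      a * norm \<Lambda> + a * norm (q + 2 *\<^sub>R (\<Lambda> *v \<mu>)) - b \<le> ?h \<xi> (x, \<alpha>, q, \<Lambda>)"
    using h_fun_lower_bound_near_mean[OF Xi Sigma psi params] by blast
  obtain \<theta> where \<theta>: "?opt \<Xi> = ereal \<theta>" using opt_value_finite[OF Xi Sigma psi params] by blast
  \<comment> \<open>The bound that coercivity gives for \<open>norm \<Lambda>\<close> and
    \<open>norm p\<close> when the objective is at most \<open>\<theta> + 1\<close> at some sample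
    near \<open>\<mu>\<close>.\<close>
  define R where "R = (\<theta> + 1 + b) / a"
  obtain d where d: "d > 0" "\<And>\<xi> \<xi>' x \<alpha> q \<Lambda>. \<xi> \<in> \<Xi> \<Longrightarrow> \<xi>' \<in> \<Xi> \<Longrightarrow> norm (\<xi>' - \<xi>) < d \<Longrightarrow>
      (x, \<alpha>, q, \<Lambda>) \<in> feasible_set \<Longrightarrow> norm \<Lambda> \<le> R \<Longrightarrow> norm (q + 2 *\<^sub>R (\<Lambda> *v \<mu>)) \<le> R \<Longrightarrow>
      ?h \<xi> (x, \<alpha>, q, \<Lambda>) \<le> ?h \<xi>' (x, \<alpha>, q, \<Lambda>) + e / 2"
    using h_fun_uniformly_continuous[OF Xi(1) psi params(2,4), of "e / 2" R \<mu> \<Sigma> \<kappa>\<^sub>1 \<kappa>\<^sub>2 \<tau>\<^sub>1] e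
    by (metis half_gt_zero)
  show ?thesis
  \<comment> \<open>\<open>min 1 a\<close> puts a point of \<open>X\<close> into the region of
    coercivity around \<open>\<mu>\<close>; \<open>d\<close> serves the comparison of
    suprema.\<close>
  proof (rule that[of "min d (min 1 a)"])
    show "min d (min 1 a) > 0" using d ab by simp
    fix X assume X: "X \<subseteq> \<Xi>" and net: "\<And>z. z \<in> \<Xi> \<Longrightarrow> \<exists>y\<in>X. norm (y - z) < min d (min 1 a)"
    have "?opt X \<le> ?opt \<Xi>"
      unfolding opt_value_def by (intro INF_mono) (use X in \<open>blast intro: SUP_subset_mono order_refl\<close>)
    moreover have "ereal (\<theta> - e / 2) \<le> ?opt X"
      unfolding opt_value_def
    proof (rule INF_greatest)
      fix \<nu> assume nu: "\<nu> \<in> (feasible_set :: 'd dual_var set)"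
      obtain x \<alpha> q \<Lambda> where \<nu>: "\<nu> = (x, \<alpha>, q, \<Lambda>)" by (metis prod.exhaust)
      define V where "V = (SUP \<xi>\<in>X. ereal (?h \<xi> \<nu>))"
      have hV: "ereal (?h \<xi> \<nu>) \<le> V" if "\<xi> \<in> X" for \<xi> unfolding V_def by (rule SUP_upper[OF that])
      have "ereal (\<theta> - e / 2) \<le> V"
      \<comment> \<open>A larger \<open>V\<close>, possibly infinite, satisfies the claim at once;
        only the other case calls for the a priori bound.\<close>
      proof (cases "V \<le> ereal (\<theta> + 1)")
        case True
        obtain \<xi>0 where \<xi>0: "\<xi>0 \<in> X" "norm (\<xi>0 - \<mu>) < min 1 a" using net[OF Xi(2)] by auto
        have "a * norm \<Lambda> + a * norm (q + 2 *\<^sub>R (\<Lambda> *v \<mu>)) - b \<le> ?h \<xi>0 \<nu>"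
          unfolding \<nu> by (rule ab(2)) (use \<xi>0 X nu \<nu> in auto)
        also have "\<dots> \<le> \<theta> + 1" using order_trans[OF hV[OF \<xi>0(1)] True] by simp
        finally have "a * norm \<Lambda> + a * norm (q + 2 *\<^sub>R (\<Lambda> *v \<mu>)) \<le> \<theta> + 1 + b" by simp
        moreover have "0 \<le> a * norm \<Lambda>" "0 \<le> a * norm (q + 2 *\<^sub>R (\<Lambda> *v \<mu>))" using ab(1) by auto
        ultimately have "a * norm \<Lambda> \<le> \<theta> + 1 + b" "a * norm (q + 2 *\<^sub>R (\<Lambda> *v \<mu>)) \<le> \<theta> + 1 + b"
          by linarith+
        then have R: "norm \<Lambda> \<le> R" "norm (q + 2 *\<^sub>R (\<Lambda> *v \<mu>)) \<le> R"
          using ab(1) by (simp_all add: R_def pos_le_divide_eq mult.commute)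
        have "?opt \<Xi> \<le> (SUP \<xi>\<in>\<Xi>. ereal (?h \<xi> \<nu>))"
          unfolding opt_value_def by (rule INF_lower[OF nu])
        also have "\<dots> \<le> V + ereal (e / 2)"
        proof (rule SUP_least)
          fix \<xi> assume \<xi>: "\<xi> \<in> \<Xi>"
          obtain \<xi>' where \<xi>': "\<xi>' \<in> X" "norm (\<xi>' - \<xi>) < d" using net[OF \<xi>] by auto
          have "?h \<xi> \<nu> \<le> ?h \<xi>' \<nu> + e / 2"
            unfolding \<nu> by (rule d(2)) (use \<xi> \<xi>' X nu \<nu> R in auto)
          then have "ereal (?h \<xi> \<nu>) \<le> ereal (?h \<xi>' \<nu>) + ereal (e / 2)" by simp
          also have "\<dots> \<le> V + ereal (e / 2)" by (intro add_right_mono hV \<xi>')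
          finally show "ereal (?h \<xi> \<nu>) \<le> V + ereal (e / 2)" .
        qed
        finally show ?thesis unfolding \<theta> by (cases V) auto
      next
        case False
        moreover have "ereal (\<theta> - e / 2) \<le> ereal (\<theta> + 1)" using e by simp
        ultimately show ?thesis by (meson le_cases order_trans)
      qed
      then show "ereal (\<theta> - e / 2) \<le> (SUP \<xi>\<in>X. ereal (?h \<xi> \<nu>))" by (simp add: V_def)
    qed
    ultimately show "\<bar>?opt X - ?opt \<Xi>\<bar> < ereal e"
      unfolding \<theta> using e by (cases "?opt X") auto
  qed
qed

section \<open>Exponential decay of the deviation probability\<close>

theorem theorem4p2:
  fixes \<Xi> :: "(real ^ ('d::finite option)) set"
    and obs :: "nat \<Rightarrow> real ^ ('d option)" and m :: nat
    and \<mu> :: "real ^ ('d option)" and \<Sigma> :: "real ^ ('d option) ^ ('d option)"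
    and \<psi> :: "real \<Rightarrow> real"
    and \<tau>\<^sub>1 \<tau>\<^sub>2 \<beta> \<kappa>\<^sub>1 \<kappa>\<^sub>2 C\<^sub>2 \<gamma>\<^sub>2 \<delta>\<^sub>0 :: real
    and P :: "(real ^ ('d option)) measure"
    and M :: "'w measure" and \<xi> :: "nat \<Rightarrow> 'w \<Rightarrow> real ^ ('d option)"
  assumes Xi: "convex \<Xi>" "compact \<Xi>"
    and obs: "m \<ge> 1" "\<And>k. k < m \<Longrightarrow> obs k \<in> \<Xi>"
    and mu: "\<mu> = sample_mean m obs"
    and Sigma: "\<Sigma> = sample_cov m obs" "pos_def \<Sigma>"
    and psi: "convex_on UNIV \<psi>"
    and params: "\<tau>\<^sub>1 \<ge> 0" "\<tau>\<^sub>2 \<ge> 0" "0 < \<beta>" "\<beta> < 1" "\<kappa>\<^sub>1 > 0" "\<kappa>\<^sub>2 > 0"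
    and finite_value: "\<And>x \<alpha>. x \<in> unit_simplex \<Longrightarrow>
          \<bar>SUP Q\<in>ambiguity_set \<Xi> \<mu> \<Sigma> \<kappa>\<^sub>1 \<kappa>\<^sub>2. ereal (\<integral>z. K_hat \<psi> \<tau>\<^sub>1 \<tau>\<^sub>2 \<beta> x \<alpha> z \<partial>Q)\<bar> \<noteq> \<infinity>"
    and P: "P \<in> borel_probs \<Xi>"
    and P_continuous: "\<And>z. z \<in> \<Xi> \<Longrightarrow> measure P {z} = 0"
    and ball_params: "C\<^sub>2 > 0" "\<gamma>\<^sub>2 > 0" "\<delta>\<^sub>0 > 0"
    and P_ball: "\<And>z\<^sub>0 \<delta>. z\<^sub>0 \<in> \<Xi> \<Longrightarrow> 0 < \<delta> \<Longrightarrow> \<delta> < \<delta>\<^sub>0 \<Longrightarrow>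
          measure P {z \<in> \<Xi>. norm (z - z\<^sub>0) < \<delta>} \<ge> C\<^sub>2 * \<delta> powr \<gamma>\<^sub>2"
    and M: "prob_space M"
    and iid: "prob_space.indep_vars M (\<lambda>_. restrict_space borel \<Xi>) \<xi> {1..}"
      "\<And>i. i \<ge> 1 \<Longrightarrow> distr M (restrict_space borel \<Xi>) (\<xi> i) = P"
  shows "\<forall>\<epsilon>>0. \<exists>C>0. \<exists>b>0. \<forall>\<^sub>F N in sequentially.
    (let E = {\<omega> \<in> space M. ereal \<epsilon> \<le>
              \<bar>opt_value \<psi> \<mu> \<Sigma> \<kappa>\<^sub>1 \<kappa>\<^sub>2 \<tau>\<^sub>1 \<tau>\<^sub>2 \<beta> ((\<lambda>i. \<xi> i \<omega>) ` {1..N})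
                - opt_value \<psi> \<mu> \<Sigma> \<kappa>\<^sub>1 \<kappa>\<^sub>2 \<tau>\<^sub>1 \<tau>\<^sub>2 \<beta> \<Xi>\<bar>}
     in E \<in> sets M \<and> measure M E \<le> C * exp (- b * real N))"
proof (intro allI impI)
  fix \<epsilon> :: real assume \<epsilon>: "\<epsilon> > 0"
  interpret prob_space M by (rule M)
  have psi_cont: "continuous_on UNIV \<psi>" using psi by (intro convex_on_continuous) auto
  have mu_Xi: "\<mu> \<in> \<Xi>" unfolding mu by (rule sample_mean_in_convex[OF Xi(1) obs])
  let ?opt = "opt_value \<psi> \<mu> \<Sigma> \<kappa>\<^sub>1 \<kappa>\<^sub>2 \<tau>\<^sub>1 \<tau>\<^sub>2 \<beta>"
  obtain \<delta> where \<delta>: "\<delta> > 0" "\<And>X. X \<subseteq> \<Xi> \<Longrightarrow> (\<And>z. z \<in> \<Xi> \<Longrightarrow> \<exists>y\<in>X. norm (y - z) < \<delta>) \<Longrightarrow>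
      \<bar>?opt X - ?opt \<Xi>\<bar> < ereal \<epsilon>"
    using opt_value_net_stability[OF Xi(2) mu_Xi Sigma(2) psi_cont params \<epsilon>] by blast
  \<comment> \<open>Two distances below \<open>r\<close>, from a point to a center and from the
    center to a sample, add up to less than \<open>\<delta>\<close>; and
    \<open>r < \<delta>\<^sub>0\<close> admits the lower bound on ball probabilities.\<close>
  define r where "r = min (\<delta> / 2) (\<delta>\<^sub>0 / 2)"
  have r: "0 < r" "r < \<delta>\<^sub>0" "r \<le> \<delta> / 2" using \<delta>(1) ball_params(3) by (auto simp: r_def)
  obtain Z where Z: "finite Z" "Z \<subseteq> \<Xi>" "\<Xi> \<subseteq> (\<Union>z\<in>Z. ball z r)"
    using seq_compact_imp_totally_bounded[OF compact_imp_seq_compact[OF Xi(2)], rule_format, OF r(1)]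
    by (elim exE conjE)
  define p where "p = C\<^sub>2 * r powr \<gamma>\<^sub>2"
  have p: "p > 0" using ball_params r(1) by (simp add: p_def)
  have Z_ball: "p \<le> measure P {y \<in> \<Xi>. norm (y - z) < r}" if "z \<in> Z" for z
    unfolding p_def using that Z(2) r by (intro P_ball) auto
  have X: "\<xi> i \<in> measurable M (restrict_space borel \<Xi>)" if "i \<ge> 1" for i
    using iid(1) that by (auto simp: indep_vars_def)
  define E where "E N = {\<omega> \<in> space M. ereal \<epsilon> \<le> \<bar>?opt ((\<lambda>i. \<xi> i \<omega>) ` {1..N}) - ?opt \<Xi>\<bar>}" for N
  \<comment> \<open>The infimum runs over an uncountable set; continuity in \<open>\<nu>\<close> and
    finiteness of the sample make the optimal value measurable nevertheless.\<close>
  have E_sets: "E N \<in> events" for N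
  proof -
    have h_meas: "(\<lambda>\<omega>. h_fun \<psi> \<mu> \<Sigma> \<kappa>\<^sub>1 \<kappa>\<^sub>2 \<tau>\<^sub>1 \<tau>\<^sub>2 \<beta> (\<xi> i \<omega>) \<nu>) \<in> borel_measurable M"
      if "i \<ge> 1" for i \<nu>
    proof (rule measurable_compose[of "\<xi> i" M borel])
      show "\<xi> i \<in> borel_measurable M"
        using X[OF that] by (simp add: measurable_restrict_space2_iff)
      show "(\<lambda>z. h_fun \<psi> \<mu> \<Sigma> \<kappa>\<^sub>1 \<kappa>\<^sub>2 \<tau>\<^sub>1 \<tau>\<^sub>2 \<beta> z \<nu>) \<in> borel_measurable borel"
        by (intro borel_measurable_continuous_onI continuous_on_h_fun psi_cont)
    qed
    have opt_eq: "?opt ((\<lambda>i. \<xi> i \<omega>) ` {1..N}) = (INF \<nu>\<in>feasible_set. SUP i\<in>{1..N}.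
        ereal (h_fun \<psi> \<mu> \<Sigma> \<kappa>\<^sub>1 \<kappa>\<^sub>2 \<tau>\<^sub>1 \<tau>\<^sub>2 \<beta> (\<xi> i \<omega>) \<nu>))" for \<omega>
      by (simp add: opt_value_def image_image)
    have [measurable]: "(\<lambda>\<omega>. ?opt ((\<lambda>i. \<xi> i \<omega>) ` {1..N})) \<in> borel_measurable M"
      unfolding opt_eq
      by (intro borel_measurable_INF_SUP_continuous continuous_on_h_fun psi_cont h_meas) auto
    show ?thesis unfolding E_def by measurable
  qed
  have E_prob: "prob (E N) \<le> (real (card Z) + 1) * exp (- p * real N)" if N: "N \<ge> 1" for N
  proof -
    define F where "F = {\<omega> \<in> space M. \<exists>z\<in>Z. \<forall>i\<in>{1..N}. \<not> norm (\<xi> i \<omega> - z) < r}"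
    have F: "F \<in> events" "prob F \<le> real (card Z) * exp (- p * real N)"
      unfolding F_def by (rule prob_ex_ball_without_sample[OF iid Z(1) Z_ball N]; assumption)+
    \<comment> \<open>Outside \<open>F\<close> every center has a sample within \<open>r\<close>, so
      the sample is a \<open>\<delta>\<close>-net of \<open>\<Xi>\<close> and the two values differ
      by less than \<epsilon>.\<close>
    have "E N \<subseteq> F"
    proof
      fix \<omega> assume \<omega>: "\<omega> \<in> E N"
      then have sp: "\<omega> \<in> space M" by (simp add: E_def)
      show "\<omega> \<in> F"
      proof (rule ccontr)
        assume "\<omega> \<notin> F"
        then have hit: "\<exists>i\<in>{1..N}. norm (\<xi> i \<omega> - z) < r" if "z \<in> Z" for z
          using sp that by (auto simp: F_def)
        have "\<bar>?opt ((\<lambda>i. \<xi> i \<omega>) ` {1..N}) - ?opt \<Xi>\<bar> < ereal \<epsilon>"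
        proof (rule \<delta>(2))
          show "(\<lambda>i. \<xi> i \<omega>) ` {1..N} \<subseteq> \<Xi>"
            using measurable_space[OF X sp] by (auto simp: space_restrict_space)
          fix z assume "z \<in> \<Xi>"
          then obtain z' where z': "z' \<in> Z" "dist z' z < r" using Z(3) by auto
          obtain i where i: "i \<in> {1..N}" "norm (\<xi> i \<omega> - z') < r" using hit[OF z'(1)] by blast
          have "norm (\<xi> i \<omega> - z) < \<delta>"
            using dist_triangle[of "\<xi> i \<omega>" z z'] i(2) z'(2) r(3) by (simp add: dist_norm)
          then show "\<exists>y\<in>(\<lambda>i. \<xi> i \<omega>) ` {1..N}. norm (y - z) < \<delta>" using i(1) by blast
        qed
        then show False using \<omega> by (simp add: E_def not_le[symmetric])
      qed
    qed
    then have "prob (E N) \<le> prob F" by (intro finite_measure_mono F)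
    \<comment> \<open>The \<open>+ 1\<close> makes the constant visibly positive. Both it and
      \<open>p\<close> depend on \<epsilon> through \<open>r\<close> and \<open>Z\<close> only, not
      on \<open>N\<close>.\<close>
    also have "\<dots> \<le> (real (card Z) + 1) * exp (- p * real N)"
      using F(2) by (rule order_trans) (simp add: mult_right_mono)
    finally show ?thesis .
  qed
  show "\<exists>C>0. \<exists>b>0. \<forall>\<^sub>F N in sequentially.
    (let E = {\<omega> \<in> space M. ereal \<epsilon> \<le> \<bar>?opt ((\<lambda>i. \<xi> i \<omega>) ` {1..N}) - ?opt \<Xi>\<bar>}
     in E \<in> sets M \<and> measure M E \<le> C * exp (- b * real N))"
    unfolding Let_def E_def[symmetric]
  proof (intro exI conjI)
    show "\<forall>\<^sub>F N in sequentially. E N \<in> events \<and>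
        prob (E N) \<le> (real (card Z) + 1) * exp (- p * real N)"
      using eventually_ge_at_top[of 1] by eventually_elim (use E_sets E_prob in auto)
  qed (use p in auto)
qed

end
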